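(* Let $d \geq 2$ be an integer and let $\tau_1,\ldots,\tau_d$ be real numbers in $]0,1[$ such that $\tau_1 + \cdots + \tau_d < 1$. Let $\rho_1,\ldots,\rho_d \in \mathbb{R}/\mathbb{Z}$ be independent over the rationals. Then there exist pairwise commuting circle diffeomorphisms $f_1,\ldots,f_d$ such that, for each $k \in \{1,\ldots,d\}$, $f_k$ is of class $C^{1+\tau_k}$ and has rotation number $\rho_k$, and none of the $f_k$ is topologically conjugate to a rotation.
   Context: Circle diffeomorphisms are orientation preserving. A map is of class $C^{1+\tau}$ ($0<\tau<1$) if it is $C^1$ and its derivative is $\tau$-Hölder continuous. Elements $\rho_1,\ldots,\rho_d \in \mathbb{R}/\mathbb{Z}$ are independent over the rationals if no nontrivial linear combination of them with rational coefficients equals a rational number. *)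

theory Defs
  imports "HOL-Analysis.Analysis"
begin

text \<open>Circle maps are represented by their lifts to the real line.
  A circle map f : R/Z -> R/Z of degree one is given by a lift F : real => real
  with F (x + 1) = F x + 1.\<close>

text \<open>F is the lift of an orientation preserving C^1 circle diffeomorphism:
  periodic displacement, continuously differentiable with everywhere positive
  derivative (so F is a strictly increasing C^1 bijection of R with C^1 inverse).\<close>
definition circle_diffeo :: "(real \<Rightarrow> real) \<Rightarrow> bool" where
  "circle_diffeo F \<longleftrightarrow>
     (\<forall>x. F (x + 1) = F x + 1) \<and>
     (\<exists>F'. (\<forall>x. (F has_real_derivative F' x) (at x)) \<and> continuous_on UNIV F' \<and> (\<forall>x. F' x > 0))"

definition C1_holder :: "real \<Rightarrow> (real \<Rightarrow> real) \<Rightarrow> bool" where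
  "C1_holder tau F \<longleftrightarrow>
     (\<exists>F'. (\<forall>x. (F has_real_derivative F' x) (at x)) \<and>
           (\<exists>C. \<forall>x y. \<bar>F' x - F' y\<bar> \<le> C * \<bar>x - y\<bar> powr tau))"

definition circle_commute :: "(real \<Rightarrow> real) \<Rightarrow> (real \<Rightarrow> real) \<Rightarrow> bool" where
  "circle_commute F G \<longleftrightarrow> (\<forall>x. F (G x) - G (F x) \<in> \<int>)"

text \<open>The circle map with lift F has rotation number r (an element of R/Z, given by a
  real representative): for some integer m, ((F^^n) x - x)/n tends to r + m for all x.\<close>
definition has_rotation_number :: "(real \<Rightarrow> real) \<Rightarrow> real \<Rightarrow> bool" where
  "has_rotation_number F r \<longleftrightarrow>
     (\<exists>m\<in>\<int>. \<forall>x. (\<lambda>n. ((F ^^ n) x - x) / real n) \<longlonglongrightarrow> r + m)"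

definition circle_homeo :: "(real \<Rightarrow> real) \<Rightarrow> bool" where
  "circle_homeo H \<longleftrightarrow> continuous_on UNIV H \<and> inj H \<and>
     ((\<forall>x. H (x + 1) = H x + 1) \<or> (\<forall>x. H (x + 1) = H x - 1))"

definition conj_to_rotation :: "(real \<Rightarrow> real) \<Rightarrow> bool" where
  "conj_to_rotation F \<longleftrightarrow>
     (\<exists>H alpha. circle_homeo H \<and> (\<forall>x. H (F x) - (H x + alpha) \<in> \<int>))"

text \<open>rho_0, ..., rho_(d-1) (real representatives of elements of R/Z) are independent over
  the rationals: no nontrivial rational linear combination is rational.\<close>
definition rationally_independent :: "nat \<Rightarrow> (nat \<Rightarrow> real) \<Rightarrow> bool" where
  "rationally_independent d \<rho> \<longleftrightarrow>
     (\<forall>q :: nat \<Rightarrow> rat. (\<Sum>k<d. of_rat (q k) * \<rho> k) \<in> \<rat> \<longrightarrow> (\<forall>k<d. q k = 0))"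

end

theory Submission
  imports Defs
begin

text \<open>
  The rotations by \<open>\<rho>\<^sub>k\<close> act freely on the subgroup of \<open>\<real>\<close> generated by 1 and the \<open>\<rho>\<^sub>k\<close>. Blow up
  each point \<open>x = \<Sum> n\<^sub>k \<rho>\<^sub>k + m\<close> of this orbit to a gap of length proportional to
  \<open>1 / \<Sum> (1 + \<bar>n\<^sub>k\<bar>) powr (1 / \<tau>\<^sub>k)\<close>. These lengths are summable modulo 1 because \<open>\<Sum> \<tau>\<^sub>k < 1\<close>, and
  translation by \<open>\<rho>\<^sub>k\<close> changes a length \<open>l\<close> by at most a constant times \<open>l powr (1 + \<tau>\<^sub>k)\<close>.
  The lift of \<open>f\<^sub>k\<close> sends each gap to its translate by a Yoccoz map. These maps satisfy the
  cocycle identity, hence the lifts commute, and they have derivative 1 at the end points, hence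
  the lifts satisfy a first-order Taylor estimate with error \<open>O(h powr (1 + \<tau>\<^sub>k))\<close> uniformly in
  both points, which is the \<open>C\<close>-\<open>(1 + \<tau>\<^sub>k)\<close> regularity. A gap is wandering and its iterates
  become arbitrarily short, which excludes a conjugacy to a rotation.
\<close>

section \<open>An equivariant family of interval diffeomorphisms\<close>

text \<open>On \<open>]0, pi[\<close> this is the map determined by \<open>cot (angle_map r x) = r * cot x\<close>, written so that
  it is smooth on the whole line.\<close>

definition angle_map :: "real \<Rightarrow> real \<Rightarrow> real" where
  "angle_map r x =
     x + arctan ((1 - r) * sin x * cos x / (r * (cos x)\<^sup>2 + (sin x)\<^sup>2))"

lemma cos_sin_combination_pos:
  fixes r x :: real
  assumes "0 < r"
  shows "0 < r * (cos x)\<^sup>2 + (sin x)\<^sup>2"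
proof (cases "sin x = 0")
  case True
  then have "(cos x)\<^sup>2 = 1"
    using sin_cos_squared_add[of x] by simp
  then show ?thesis using assms True by simp
next
  case False
  then have "0 < (sin x)\<^sup>2" by simp
  moreover have "0 \<le> r * (cos x)\<^sup>2" using assms by simp
  ultimately show ?thesis by linarith
qed

text \<open>Lagrange's identity for the vectors (r cos x, sin x) and (cos x, sin x), the second of
  norm 1. It supplies the denominator both in the derivative of \<open>arctan\<close> and in the
  sine of an arctangent.\<close>

lemma angle_map_arg_identity:
  fixes r x :: real
  assumes "0 < r"
  shows "1 + ((1 - r) * sin x * cos x / (r * (cos x)\<^sup>2 + (sin x)\<^sup>2))\<^sup>2 =
     (r\<^sup>2 * (cos x)\<^sup>2 + (sin x)\<^sup>2) / (r * (cos x)\<^sup>2 + (sin x)\<^sup>2)\<^sup>2"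
proof -
  have N: "r * (cos x)\<^sup>2 + (sin x)\<^sup>2 \<noteq> 0"
    using cos_sin_combination_pos[OF assms, of x] by simp
  have s: "(sin x)\<^sup>2 = 1 - (cos x)\<^sup>2" by (simp add: sin_squared_eq)
  have "(r * (cos x)\<^sup>2 + (sin x)\<^sup>2)\<^sup>2 + (1 - r)\<^sup>2 * (sin x)\<^sup>2 * (cos x)\<^sup>2 =
      r\<^sup>2 * (cos x)\<^sup>2 + (sin x)\<^sup>2"
    unfolding s by algebra
  then show ?thesis
    using N by (simp add: power_divide power_mult_distrib add_divide_eq_iff)
qed

lemma angle_map_deriv:
  assumes "0 < r"
  shows "(angle_map r has_real_derivative r / (r\<^sup>2 * (cos x)\<^sup>2 + (sin x)\<^sup>2)) (at x)"
proof -
  let ?N = "r * (cos x)\<^sup>2 + (sin x)\<^sup>2"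
  let ?D = "r\<^sup>2 * (cos x)\<^sup>2 + (sin x)\<^sup>2"
  let ?z = "(1 - r) * sin x * cos x / ?N"
  let ?z' = "(1 - r) * (((cos x)\<^sup>2 - (sin x)\<^sup>2) * ?N - 2 * (1 - r) * (sin x)\<^sup>2 * (cos x)\<^sup>2) / ?N\<^sup>2"
  have N: "?N \<noteq> 0" using cos_sin_combination_pos[OF assms, of x] by simp
  have D: "?D \<noteq> 0" using cos_sin_combination_pos[of "r\<^sup>2" x] assms by simp
  have s: "(sin x)\<^sup>2 = 1 - (cos x)\<^sup>2" by (simp add: sin_squared_eq)
  have "((\<lambda>x. (1 - r) * sin x * cos x) has_real_derivative (1 - r) * ((cos x)\<^sup>2 - (sin x)\<^sup>2)) (at x)"
    by (auto intro!: derivative_eq_intros simp: power2_eq_square algebra_simps)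
  moreover have "((\<lambda>x. r * (cos x)\<^sup>2 + (sin x)\<^sup>2) has_real_derivative 2 * (1 - r) * sin x * cos x) (at x)"
    by (auto intro!: derivative_eq_intros simp: algebra_simps)
  ultimately have "((\<lambda>x. (1 - r) * sin x * cos x / (r * (cos x)\<^sup>2 + (sin x)\<^sup>2)) has_real_derivative
      ((1 - r) * ((cos x)\<^sup>2 - (sin x)\<^sup>2) * ?N - (1 - r) * sin x * cos x * (2 * (1 - r) * sin x * cos x))
      / (?N * ?N)) (at x)"
    by (rule DERIV_divide) (rule N)
  also have "((1 - r) * ((cos x)\<^sup>2 - (sin x)\<^sup>2) * ?N - (1 - r) * sin x * cos x * (2 * (1 - r) * sin x * cos x))
      / (?N * ?N) = ?z'"
    unfolding power2_eq_square[of ?N] by (rule arg_cong[of _ _ "\<lambda>v. v / (?N * ?N)"]) algebra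
  finally have "((\<lambda>x. (1 - r) * sin x * cos x / (r * (cos x)\<^sup>2 + (sin x)\<^sup>2)) has_real_derivative ?z') (at x)" .
  then have "(angle_map r has_real_derivative 1 + ?z' / (1 + ?z\<^sup>2)) (at x)"
    unfolding angle_map_def[abs_def]
    by (intro DERIV_add DERIV_ident) (use DERIV_chain2[OF DERIV_arctan] in \<open>fastforce simp: field_simps\<close>)
  moreover have "1 + ?z' / (1 + ?z\<^sup>2) = r / ?D"
  proof -
    \<comment> \<open>Over the common denominator \<open>?D\<close> this is the numerator of the
      derivative, and it collapses to r.\<close>
    have "?D + (1 - r) * (((cos x)\<^sup>2 - (sin x)\<^sup>2) * ?N - 2 * (1 - r) * (sin x)\<^sup>2 * (cos x)\<^sup>2) = r"
      unfolding s by (simp add: algebra_simps power2_eq_square)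
    moreover have "1 + u / v\<^sup>2 / (w / v\<^sup>2) = (w + u) / w" if "v \<noteq> 0" "w \<noteq> 0" for u v w :: real
      using that by (simp add: field_simps)
    ultimately show ?thesis
      unfolding angle_map_arg_identity[OF assms] using N D by metis
  qed
  ultimately show ?thesis by simp
qed

text \<open>This is sin^2 = 1 / (1 + cot^2) under the rule cot y = r cot x. Only the squared sine
  enters the derivative formula, so no sign has to be tracked.\<close>

lemma sin_angle_map_squared:
  assumes "0 < r"
  shows "(sin (angle_map r x))\<^sup>2 = (sin x)\<^sup>2 / (r\<^sup>2 * (cos x)\<^sup>2 + (sin x)\<^sup>2)"
proof -
  let ?N = "r * (cos x)\<^sup>2 + (sin x)\<^sup>2"
  let ?D = "r\<^sup>2 * (cos x)\<^sup>2 + (sin x)\<^sup>2"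
  let ?z = "(1 - r) * sin x * cos x / ?N"
  have N: "?N \<noteq> 0" using cos_sin_combination_pos[OF assms, of x] by simp
  have D: "?D \<noteq> 0" using cos_sin_combination_pos[of "r\<^sup>2" x] assms by simp
  have z: "0 < 1 + ?z\<^sup>2" by (simp add: add_pos_nonneg)
  have s: "(sin x)\<^sup>2 = 1 - (cos x)\<^sup>2" by (simp add: sin_squared_eq)
  have "sin (angle_map r x) = (sin x + ?z * cos x) / sqrt (1 + ?z\<^sup>2)"
    unfolding angle_map_def sin_add by (simp add: sin_arctan cos_arctan add_divide_distrib mult.commute)
  then have "(sin (angle_map r x))\<^sup>2 = (sin x + ?z * cos x)\<^sup>2 / (1 + ?z\<^sup>2)"
    using z by (simp add: power_divide)
  also have "sin x + ?z * cos x = sin x / ?N"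
  proof -
    have "sin x * ?N + (1 - r) * sin x * cos x * cos x = sin x * (?N + (1 - r) * (cos x)\<^sup>2)"
      by algebra
    also have "?N + (1 - r) * (cos x)\<^sup>2 = 1" unfolding s by algebra
    finally have *: "sin x * ?N + (1 - r) * sin x * cos x * cos x = sin x"
      unfolding mult_1_right .
    have "u + v / n * w = (u * n + v * w) / n" if "n \<noteq> 0" for u v w n :: real
      using that by (simp add: field_simps)
    from this[OF N, of "sin x" "(1 - r) * sin x * cos x" "cos x"] show ?thesis unfolding * .
  qed
  also have "(sin x / ?N)\<^sup>2 / (1 + ?z\<^sup>2) = (sin x)\<^sup>2 / ?D"
    unfolding angle_map_arg_identity[OF assms] using N D by (simp add: power_divide)
  finally show ?thesis .
qed

lemma angle_map_0 [simp]: "angle_map r 0 = 0" and angle_map_pi [simp]: "angle_map r pi = pi"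
  by (simp_all add: angle_map_def)

text \<open>Cotangents are multiplied by r and then by q. To avoid their poles, the two sides are
  compared through equal derivatives and a common value at 0, which works on the whole line.\<close>

lemma angle_map_compose:
  assumes "0 < r" "0 < q"
  shows "angle_map q (angle_map r x) = angle_map (q * r) x"
proof -
  let ?h = "\<lambda>x. angle_map q (angle_map r x) - angle_map (q * r) x"
  have "(?h has_real_derivative 0) (at x)" for x
  proof -
    let ?y = "angle_map r x"
    let ?D = "r\<^sup>2 * (cos x)\<^sup>2 + (sin x)\<^sup>2"
    have D: "?D \<noteq> 0" using cos_sin_combination_pos[of "r\<^sup>2" x] assms by simp
    have E: "(q * r)\<^sup>2 * (cos x)\<^sup>2 + (sin x)\<^sup>2 \<noteq> 0"
      using cos_sin_combination_pos[of "(q * r)\<^sup>2" x] assms by simp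
    have qr: "0 < q * r" using assms by simp
    have "(cos ?y)\<^sup>2 = r\<^sup>2 * (cos x)\<^sup>2 / ?D"
      using D by (simp add: cos_squared_eq sin_angle_map_squared[OF assms(1)] field_simps)
    then have "q\<^sup>2 * (cos ?y)\<^sup>2 + (sin ?y)\<^sup>2 = ((q * r)\<^sup>2 * (cos x)\<^sup>2 + (sin x)\<^sup>2) / ?D"
      using sin_angle_map_squared[OF assms(1), of x] D by (simp add: field_simps)
    then have *: "q / (q\<^sup>2 * (cos ?y)\<^sup>2 + (sin ?y)\<^sup>2) * (r / ?D) =
        q * r / ((q * r)\<^sup>2 * (cos x)\<^sup>2 + (sin x)\<^sup>2)"
      using D E by (simp add: field_simps)
    show ?thesis
      using DERIV_diff[OF DERIV_chain2[OF angle_map_deriv[OF assms(2)] angle_map_deriv[OF assms(1)]]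
          angle_map_deriv[OF qr], of x] unfolding * by simp
  qed
  then have "?h x = ?h 0" by (intro DERIV_isconst_all) auto
  then show ?thesis by simp
qed

text \<open>The diffeomorphism from \<open>[0, a]\<close> to \<open>[0, b]\<close>; for \<open>a = b = 0\<close> the divisions by zero make
  it the identity on \<open>{0}\<close>, with formal derivative 1.\<close>

definition yoccoz :: "real \<Rightarrow> real \<Rightarrow> real \<Rightarrow> real" where
  "yoccoz a b t = b / pi * angle_map (b / a) (pi * t / a)"

definition yoccoz_deriv :: "real \<Rightarrow> real \<Rightarrow> real \<Rightarrow> real" where
  "yoccoz_deriv a b t = 1 / (1 + ((a / b)\<^sup>2 - 1) * (sin (pi * t / a))\<^sup>2)"

lemma yoccoz_0 [simp]: "yoccoz a b 0 = 0"
  by (simp add: yoccoz_def)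

lemma yoccoz_end: "(a = 0 \<longleftrightarrow> b = 0) \<Longrightarrow> yoccoz a b a = b"
  by (cases "a = 0") (simp_all add: yoccoz_def)

lemma yoccoz_deriv_0 [simp]: "yoccoz_deriv a b 0 = 1"
  and yoccoz_deriv_end [simp]: "yoccoz_deriv a b a = 1"
  by (cases "a = 0"; simp add: yoccoz_deriv_def)+

text \<open>The ratios multiply: (c / b)(b / a) = c / a. This is the cocycle identity behind
  commutation.\<close>

lemma yoccoz_compose:
  assumes "0 < a" "0 < b" "0 < c"
  shows "yoccoz b c (yoccoz a b t) = yoccoz a c t"
  using assms angle_map_compose[of "b / a" "c / b" "pi * t / a"]
  by (simp add: yoccoz_def)

lemma yoccoz_has_deriv:
  assumes "0 < a" "0 < b"
  shows "(yoccoz a b has_real_derivative yoccoz_deriv a b t) (at t)"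
proof -
  let ?x = "pi * t / a"
  let ?D = "(b / a)\<^sup>2 * (cos ?x)\<^sup>2 + (sin ?x)\<^sup>2"
  have D: "?D \<noteq> 0" using cos_sin_combination_pos[of "(b / a)\<^sup>2" ?x] assms by simp
  have r: "0 < b / a" using assms by simp
  have "((\<lambda>t. pi * t / a) has_real_derivative pi / a) (at t)"
    using assms by (auto intro!: derivative_eq_intros)
  from DERIV_cmult[OF DERIV_chain2[OF angle_map_deriv[OF r] this], of "b / pi"]
  have "(yoccoz a b has_real_derivative b / pi * (b / a / ?D * (pi / a))) (at t)"
    unfolding yoccoz_def .
  moreover have "b / pi * (b / a / ?D * (pi / a)) = yoccoz_deriv a b t"
  proof -
    have "?D = (b / a)\<^sup>2 * (1 + ((a / b)\<^sup>2 - 1) * (sin ?x)\<^sup>2)"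
      using assms by (simp add: cos_squared_eq field_simps)
    moreover have "b / pi * (b / a / ?D * (pi / a)) = (b / a)\<^sup>2 / ?D"
      by (simp add: power2_eq_square)
    ultimately show ?thesis
      using assms by (simp add: yoccoz_deriv_def)
  qed
  ultimately show ?thesis by simp
qed

text \<open>The right side is the convex combination cos^2 x * 1 + sin^2 x * (a / b)^2 of two
  numbers that are at least 1 / M^2.\<close>

lemma yoccoz_deriv_denominator:
  fixes a b M x :: real
  assumes "0 < a" "0 < b" "1 \<le> M" "b \<le> M * a"
  shows "1 / M\<^sup>2 \<le> 1 + ((a / b)\<^sup>2 - 1) * (sin x)\<^sup>2"
proof -
  have "1 / M \<le> a / b" using assms by (simp add: divide_le_eq le_divide_eq mult.commute)
  then have 1: "1 / M\<^sup>2 \<le> (a / b)\<^sup>2"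
    using assms power_mono[of "1 / M" "a / b" 2] by (simp add: power_divide)
  have 2: "1 / M\<^sup>2 \<le> 1" using assms by (simp add: field_simps)
  have "1 / M\<^sup>2 = 1 / M\<^sup>2 * (cos x)\<^sup>2 + 1 / M\<^sup>2 * (sin x)\<^sup>2"
    by (simp add: cos_squared_eq algebra_simps)
  also have "\<dots> \<le> 1 * (cos x)\<^sup>2 + (a / b)\<^sup>2 * (sin x)\<^sup>2"
    using 1 2 by (intro add_mono mult_right_mono) auto
  also have "\<dots> = 1 + ((a / b)\<^sup>2 - 1) * (sin x)\<^sup>2"
    by (simp add: cos_squared_eq algebra_simps)
  finally show ?thesis .
qed

lemma yoccoz_deriv_pos:
  assumes "a = 0 \<longleftrightarrow> b = 0" "0 \<le> a" "0 \<le> b"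
  shows "0 < yoccoz_deriv a b t"
proof (cases "a = 0")
  case True
  then show ?thesis by (simp add: yoccoz_deriv_def)
next
  case False
  then have ab: "0 < a" "0 < b" using assms by auto
  \<comment> \<open>The least M to which the bound on the denominator applies.\<close>
  define M where "M = max 1 (b / a)"
  have "1 \<le> M" "b \<le> M * a" using ab by (auto simp: M_def field_simps max_def)
  from yoccoz_deriv_denominator[OF ab this, of "pi * t / a"] \<open>1 \<le> M\<close>
  show ?thesis unfolding yoccoz_deriv_def
    by (smt (verit) divide_pos_pos zero_less_power)
qed

lemma yoccoz_mono:
  assumes "0 < a" "0 < b" "s \<le> t"
  shows "yoccoz a b s \<le> yoccoz a b t"
  using yoccoz_has_deriv[OF assms(1,2)] yoccoz_deriv_pos[of a b] assms
  by (intro DERIV_nonneg_imp_nondecreasing[OF assms(3)]) (metis less_imp_le less_numeral_extra(3))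

lemma yoccoz_range:
  assumes "a = 0 \<longleftrightarrow> b = 0" "0 \<le> a" "0 \<le> b" "0 \<le> t" "t \<le> a"
  shows "0 \<le> yoccoz a b t" "yoccoz a b t \<le> b"
proof -
  have "0 \<le> yoccoz a b t \<and> yoccoz a b t \<le> b"
  proof (cases "a = 0")
    case True
    then show ?thesis using assms by simp
  next
    case False
    then have ab: "0 < a" "0 < b" using assms by auto
    then show ?thesis
      using yoccoz_mono[OF ab assms(4)] yoccoz_mono[OF ab assms(5)] yoccoz_end[OF assms(1)] by simp
  qed
  then show "0 \<le> yoccoz a b t" "yoccoz a b t \<le> b" by auto
qed

section \<open>Uniform Holder and Taylor estimates for the Yoccoz maps\<close>

lemma sin_squared_diff_le: "\<bar>(sin x)\<^sup>2 - (sin y)\<^sup>2\<bar> \<le> \<bar>x - y\<bar>" for x y :: real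
proof -
  have "(sin x)\<^sup>2 - (sin y)\<^sup>2 = sin (x + y) * sin (x - y)"
    by (simp add: sin_add sin_diff sin_squared_eq algebra_simps power2_eq_square)
       (simp add: sin_squared_eq algebra_simps flip: power2_eq_square mult.assoc)
  also have "\<bar>\<dots>\<bar> \<le> 1 * \<bar>x - y\<bar>"
    unfolding abs_mult by (intro mult_mono abs_sin_x_le_abs_x) auto
  finally show ?thesis by simp
qed

text \<open>The reciprocal of the derivative is 1 + \<kappa> sin^2 (pi t / a). The hypothesis on the
  lengths makes \<kappa> of order \<open>a powr \<tau>\<close>, while the squared sine varies by at
  most pi |t - s| / a <= pi (|t - s| / a)^\<tau>, as |t - s| <= a. The powers of a cancel, so the
  constant does not depend on a.\<close>

lemma yoccoz_deriv_holder:
  assumes ab: "0 < a" "0 < b" and M: "1 \<le> M" "b \<le> M * a" "a \<le> M * b"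
    and C: "\<bar>b - a\<bar> \<le> C * a powr (1 + \<tau>)"
    and \<tau>: "0 < \<tau>" "\<tau> < 1" and st: "s \<in> {0..a}" "t \<in> {0..a}"
  shows "\<bar>yoccoz_deriv a b t - yoccoz_deriv a b s\<bar> \<le> C * (1 + M) * M ^ 6 * pi * \<bar>t - s\<bar> powr \<tau>"
proof -
  define \<kappa> where "\<kappa> = (a / b)\<^sup>2 - 1"
  define P where "P t = 1 + \<kappa> * (sin (pi * t / a))\<^sup>2" for t
  have P: "1 / M\<^sup>2 \<le> P t" for t
    unfolding P_def \<kappa>_def by (rule yoccoz_deriv_denominator[OF ab M(1,2)])
  have M2: "0 < 1 / M\<^sup>2" using M by simp
  have Ppos: "0 < P t" for t using P[of t] M2 by linarith
  have Pinv: "1 / P t \<le> M\<^sup>2" for t using P[of t] Ppos[of t] M by (simp add: field_simps)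
  have C0: "0 \<le> C" using C ab
    by (metis abs_ge_zero order_trans powr_gt_zero zero_le_mult_iff not_less less_imp_neq)
  have \<kappa>: "\<bar>\<kappa>\<bar> \<le> C * (1 + M) * M\<^sup>2 * a powr \<tau>"
  proof -
    have "\<kappa> = (a - b) * (a + b) * (1 / b)\<^sup>2"
      using ab by (simp add: \<kappa>_def field_simps power2_eq_square)
    then have "\<bar>\<kappa>\<bar> = \<bar>b - a\<bar> * (a + b) * (1 / b)\<^sup>2"
      using ab by (simp add: abs_mult)
    also have "\<dots> \<le> (C * a powr (1 + \<tau>)) * (a + M * a) * (M / a)\<^sup>2"
      using ab M C C0 by (intro mult_mono power_mono) (auto simp: field_simps)
    also have "\<dots> = C * (1 + M) * M\<^sup>2 * a powr \<tau>"
      using ab by (simp add: powr_add field_simps power2_eq_square)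
    finally show ?thesis .
  qed
  define \<delta> where "\<delta> = \<bar>t - s\<bar>"
  have "\<delta> / a \<le> (\<delta> / a) powr \<tau>"
  proof (cases "\<delta> = 0")
    case False
    then have d: "0 < \<delta> / a" "\<delta> / a \<le> 1" using st ab by (auto simp: \<delta>_def)
    then show ?thesis using powr_mono'[of \<tau> 1 "\<delta> / a"] \<tau> by (simp del: abs_divide)
  qed simp
  also have "\<dots> = \<delta> powr \<tau> / a powr \<tau>" using ab by (simp add: \<delta>_def powr_divide)
  finally have d: "a powr \<tau> * (\<delta> / a) \<le> \<delta> powr \<tau>" using ab by (simp add: field_simps)
  have "\<bar>P s - P t\<bar> = \<bar>\<kappa>\<bar> * \<bar>(sin (pi * s / a))\<^sup>2 - (sin (pi * t / a))\<^sup>2\<bar>"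
    unfolding P_def by (simp flip: abs_mult right_diff_distrib)
  also have "\<dots> \<le> \<bar>\<kappa>\<bar> * \<bar>pi * s / a - pi * t / a\<bar>"
    by (intro mult_left_mono sin_squared_diff_le) auto
  also have "\<bar>pi * s / a - pi * t / a\<bar> = pi * (\<delta> / a)"
  proof -
    have "pi * s / a - pi * t / a = pi / a * (s - t)"
      by (simp add: diff_divide_distrib right_diff_distrib)
    then show ?thesis using ab by (simp add: \<delta>_def abs_mult abs_minus_commute)
  qed
  also have "\<bar>\<kappa>\<bar> * (pi * (\<delta> / a)) \<le> (C * (1 + M) * M\<^sup>2 * a powr \<tau>) * (pi * (\<delta> / a))"
    using ab by (intro mult_right_mono \<kappa>) (auto simp: \<delta>_def)
  also have "\<dots> = C * (1 + M) * M\<^sup>2 * pi * (a powr \<tau> * (\<delta> / a))" by simp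
  also have "\<dots> \<le> C * (1 + M) * M\<^sup>2 * pi * \<delta> powr \<tau>"
    using C0 M by (intro mult_left_mono d) auto
  finally have Pd: "\<bar>P s - P t\<bar> \<le> C * (1 + M) * M\<^sup>2 * pi * \<delta> powr \<tau>" .
  \<comment> \<open>Each of the two reciprocals costs a factor M^2, which turns M^2 into
    M^6.\<close>
  have "1 / P t - 1 / P s = (P s - P t) * (1 / P t) * (1 / P s)"
    using Ppos[of s] Ppos[of t] by (simp add: field_simps)
  then have "\<bar>1 / P t - 1 / P s\<bar> = \<bar>P s - P t\<bar> * (1 / P t) * (1 / P s)"
    using Ppos[of s] Ppos[of t] by (simp add: abs_mult)
  also have "\<dots> \<le> (C * (1 + M) * M\<^sup>2 * pi * \<delta> powr \<tau>) * M\<^sup>2 * M\<^sup>2"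
    using Ppos[of s] Ppos[of t] C0 M
    by (intro mult_mono Pd Pinv) auto
  also have "\<dots> = C * (1 + M) * M ^ 6 * pi * \<delta> powr \<tau>"
    by (simp add: power2_eq_square power_numeral_reduce)
  finally show ?thesis by (simp add: yoccoz_deriv_def P_def \<kappa>_def \<delta>_def)
qed

text \<open>By the mean value theorem the increment is (t - s) times the derivative at a point
  between s and t, and the Holder estimate compares that derivative with the one at s.\<close>

lemma yoccoz_taylor:
  assumes ab: "0 < a" "0 < b" and M: "1 \<le> M" "b \<le> M * a" "a \<le> M * b"
    and C: "\<bar>b - a\<bar> \<le> C * a powr (1 + \<tau>)"
    and \<tau>: "0 < \<tau>" "\<tau> < 1" and st: "s \<in> {0..a}" "t \<in> {0..a}"
  shows "\<bar>yoccoz a b t - yoccoz a b s - yoccoz_deriv a b s * (t - s)\<bar>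
     \<le> C * (1 + M) * M ^ 6 * pi * \<bar>t - s\<bar> powr (1 + \<tau>)"
proof (cases "s = t")
  case False
  have "\<exists>z. min s t < z \<and> z < max s t \<and>
      yoccoz a b (max s t) - yoccoz a b (min s t) = (max s t - min s t) * yoccoz_deriv a b z"
    using False by (intro MVT2 yoccoz_has_deriv ab) auto
  then obtain z where z: "min s t < z" "z < max s t"
    "yoccoz a b (max s t) - yoccoz a b (min s t) = (max s t - min s t) * yoccoz_deriv a b z" by blast
  have C0: "0 \<le> C" using C ab
    by (metis abs_ge_zero order_trans powr_gt_zero zero_le_mult_iff not_less less_imp_neq)
  have eq: "yoccoz a b t - yoccoz a b s = yoccoz_deriv a b z * (t - s)"
    using z(3) by (cases "s < t") (auto simp: min_def max_def algebra_simps split: if_splits)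
  have zin: "z \<in> {0..a}" using z st by auto
  have zs: "\<bar>z - s\<bar> \<le> \<bar>t - s\<bar>" using z by (auto simp: min_def max_def split: if_splits)
  have "\<bar>yoccoz a b t - yoccoz a b s - yoccoz_deriv a b s * (t - s)\<bar> =
      \<bar>yoccoz_deriv a b z - yoccoz_deriv a b s\<bar> * \<bar>t - s\<bar>"
    unfolding eq by (simp flip: abs_mult left_diff_distrib)
  also have "\<dots> \<le> (C * (1 + M) * M ^ 6 * pi * \<bar>z - s\<bar> powr \<tau>) * \<bar>t - s\<bar>"
    by (intro mult_right_mono yoccoz_deriv_holder[OF ab M C \<tau> st(1) zin]) auto
  also have "\<dots> \<le> (C * (1 + M) * M ^ 6 * pi * \<bar>t - s\<bar> powr \<tau>) * \<bar>t - s\<bar>"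
    using C0 M zs \<tau> by (intro mult_right_mono mult_left_mono powr_mono2) auto
  also have "\<dots> = C * (1 + M) * M ^ 6 * pi * \<bar>t - s\<bar> powr (1 + \<tau>)"
    using False by (simp add: powr_add)
  finally show ?thesis .
qed simp

section \<open>Blowing up a countable set of points\<close>

text \<open>\<open>len x\<close> is the length of the gap to be inserted at x. Summability over a
  period forces it to vanish outside a countable set.\<close>

locale gap_lengths =
  fixes len :: "real \<Rightarrow> real"
  assumes len_nonneg [simp]: "0 \<le> len x"
    and len_periodic [simp]: "len (x + 1) = len x"
    and len_summable: "len summable_on {0..<1}"
    and len_total: "infsum len {0..<1} < 1"
begin

section \<open>Total gap length of a bounded set\<close>

abbreviation mass :: "real set \<Rightarrow> real" where
  "mass \<equiv> infsum len"

lemma len_add_int [simp]: "len (x + of_int n) = len x"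
proof (induction n arbitrary: x rule: int_induct[of _ 0])
  case (step1 i)
  have "len (x + of_int (i + 1)) = len (x + of_int i + 1)" by (simp add: add.assoc)
  then show ?case using step1 by (simp del: of_int_add)
next
  case (step2 i)
  have "len (x + of_int (i - 1)) = len (x + of_int (i - 1) + 1)" by (rule len_periodic[symmetric])
  also have "\<dots> = len (x + of_int i)" by simp
  finally show ?case using step2 by simp
qed simp

lemma mass_add_int: "mass ((\<lambda>x. x + of_int n) ` A) = mass A"
  by (subst infsum_reindex) (auto simp: inj_on_def o_def)

text \<open>A bounded set is covered by finitely many integer translates of the unit interval. This
  licenses additivity of \<open>mass\<close>, since \<open>infsum\<close> defaults to 0 on families
  that are not summable.\<close>

lemma summable_bounded:
  assumes "bounded A"
  shows "len summable_on A"
proof -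
  have unit: "len summable_on {of_int k..<of_int k + 1}" for k :: int
  proof -
    have "{of_int k..<of_int k + 1} = (\<lambda>x. x + of_int k) ` {0..<1 :: real}"
      by (simp add: add.commute)
    then show ?thesis
      using len_summable by (simp only: summable_on_reindex inj_on_add') (simp add: o_def)
  qed
  have sym: "len summable_on {- real n..<real n}" for n
  proof (induction n)
    case (Suc n)
    have "{- real (Suc n)..<real (Suc n)} =
        {of_int (- int n - 1)..<of_int (- int n - 1) + 1} \<union> {- real n..<real n} \<union>
        {of_int (int n)..<of_int (int n) + 1}"
      by auto
    then show ?case
      using Suc unit by (simp only:) (intro summable_on_union)
  qed simp
  obtain B where B: "\<And>x. x \<in> A \<Longrightarrow> \<bar>x\<bar> \<le> B"
    using assms by (auto simp: bounded_iff)
  obtain n where "B < real n" using reals_Archimedean2 by blast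
  then have "A \<subseteq> {- real n..<real n}" using B by fastforce
  then show ?thesis using sym summable_on_subset by blast
qed

lemma mass_nonneg [simp]: "0 \<le> mass A"
  by (rule infsum_nonneg) simp

lemma mass_Un:
  assumes "bounded A" "bounded B" "A \<inter> B = {}"
  shows "mass (A \<union> B) = mass A + mass B"
  using assms by (intro infsum_Un_disjoint summable_bounded)

lemma mass_mono:
  assumes "A \<subseteq> B" "bounded B"
  shows "mass A \<le> mass B"
  using assms by (intro infsum_mono2) (auto intro: summable_bounded bounded_subset)

lemma mass_interval:
  assumes "a \<le> b" "b \<le> c"
  shows "mass {a..<c} = mass {a..<b} + mass {b..<c}"
  using assms by (subst mass_Un[symmetric]) (auto simp: ivl_disj_un)

lemma mass_period: "mass {x..<x + 1} = mass {0..<1}"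
proof -
  define n where "n = real_of_int \<lfloor>x\<rfloor>"
  have n: "n \<le> x" "x \<le> n + 1" unfolding n_def by linarith+
  have "mass {x..<x + 1} = mass {x..<n + 1} + mass {n + 1..<x + 1}"
    using n by (intro mass_interval) auto
  also have "mass {n + 1..<x + 1} = mass {n..<x}"
    using mass_add_int[of 1 "{n..<x}"] by (simp add: add.commute)
  also have "mass {x..<n + 1} + mass {n..<x} = mass {n..<n + 1}"
    using n mass_interval[of n x "n + 1"] by simp
  also have "\<dots> = mass {0..<1}"
    using mass_add_int[of "\<lfloor>x\<rfloor>" "{0..<1}"] by (simp add: n_def add.commute)
  finally show ?thesis .
qed

section \<open>Positions of the gaps\<close>

definition weight :: real where
  "weight = 1 - mass {0..<1}"

lemma weight_pos [simp]: "0 < weight"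
  using len_total by (simp add: weight_def)

text \<open>The gap inserted at \<open>x\<close> is \<open>[gap_start x, gap_start x + len x]\<close>; where \<open>len\<close> vanishes it is a
  single point. The term \<open>weight * x\<close> makes the gaps and the rest of the circle fill length 1.\<close>

definition gap_start :: "real \<Rightarrow> real" where
  "gap_start x = weight * x + (if 0 \<le> x then mass {0..<x} else - mass {x..<0})"

lemma gap_start_diff:
  assumes "x \<le> y"
  shows "gap_start y = gap_start x + weight * (y - x) + mass {x..<y}"
  using assms mass_interval[of 0 x y] mass_interval[of x 0 y] mass_interval[of x y 0]
  by (auto simp: gap_start_def algebra_simps)

text \<open>The half-open interval from x to y counts the gap at x but not the one at y. Splitting
  off \<open>len x\<close> exhibits the jump of \<open>gap_start\<close> at x.\<close>

lemma gap_start_less: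
  assumes "x < y"
  shows "gap_start y = gap_start x + len x + weight * (y - x) + mass {x<..<y}"
proof -
  have "{x..<y} = {x} \<union> {x<..<y}" using assms by auto
  then have "mass {x..<y} = len x + mass {x<..<y}"
    by (subst mass_Un[symmetric, of "{x}", simplified]) auto
  then show ?thesis using gap_start_diff[of x y] assms by simp
qed

text \<open>Positivity of \<open>weight\<close> gives strictness, so closed gaps at distinct points
  are disjoint.\<close>

lemma gap_start_strict:
  assumes "x < y"
  shows "gap_start x + len x < gap_start y"
  using gap_start_less[OF assms] assms mass_nonneg[of "{x<..<y}"]
    mult_pos_pos[OF weight_pos, of "y - x"] by linarith

lemma gap_start_mono:
  assumes "x \<le> y"
  shows "gap_start x \<le> gap_start y"
proof (cases "x = y")
  case False
  then show ?thesis using gap_start_strict[of x y] assms len_nonneg[of x] by linarith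
qed simp

lemma gap_start_add_1: "gap_start (x + 1) = gap_start x + 1"
  using gap_start_diff[of x "x + 1"] mass_period[of x] by (simp add: weight_def)

lemma gap_start_int [simp]: "gap_start (of_int n) = of_int n"
proof (induction n rule: int_induct[of _ 0])
  case base
  then show ?case by (simp add: gap_start_def)
next
  case (step1 i)
  then show ?case using gap_start_add_1[of "of_int i"] by simp
next
  case (step2 i)
  then show ?case using gap_start_add_1[of "of_int i - 1"] by simp
qed

text \<open>Finitely many points carry all but \<epsilon> / 2 of the mass near x, and a small
  interval around x avoids them.\<close>

lemma mass_punctured_small:
  assumes "0 < \<epsilon>"
  obtains \<delta> where "0 < \<delta>" "mass ({x - \<delta><..<x + \<delta>} - {x}) < \<epsilon>"
proof -
  let ?A = "{x - 1<..<x + 1} - {x}"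
  have bA: "bounded ?A" by (rule bounded_subset[of "{x - 1<..<x + 1}"]) auto
  obtain B where B: "finite B" "B \<subseteq> ?A" "dist (sum len B) (mass ?A) \<le> \<epsilon> / 2"
    using infsum_finite_approximation[OF summable_bounded[OF bA], of "\<epsilon> / 2"] assms by auto
  \<comment> \<open>The inserted 1 keeps the minimum defined for empty \<open>B\<close> and the
    interval inside radius 1.\<close>
  define \<delta> where "\<delta> = Min (insert 1 ((\<lambda>b. \<bar>b - x\<bar>) ` B))"
  have "0 < \<delta>" using B by (auto simp: \<delta>_def)
  have \<delta>: "\<delta> \<le> 1" "\<And>b. b \<in> B \<Longrightarrow> \<delta> \<le> \<bar>b - x\<bar>" using B(1) by (auto simp: \<delta>_def)
  have "{x - \<delta><..<x + \<delta>} - {x} \<subseteq> ?A - B" using \<delta> by fastforce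
  then have "mass ({x - \<delta><..<x + \<delta>} - {x}) \<le> mass (?A - B)"
    using bA by (intro mass_mono) (auto intro: bounded_subset)
  also have "mass (?A - B) = mass ?A - sum len B"
  proof -
    have "bounded (?A - B)" using bA by (rule bounded_subset) auto
    then have "mass (?A - B \<union> B) = mass (?A - B) + mass B"
      using finite_imp_bounded[OF B(1)] by (intro mass_Un) auto
    moreover have "?A - B \<union> B = ?A" using B(2) by blast
    ultimately show ?thesis using B(1) by simp
  qed
  also have "\<dots> < \<epsilon>" using B(3) assms unfolding dist_real_def by linarith
  finally show ?thesis using that \<open>0 < \<delta>\<close> by blast
qed

section \<open>Collapsing the gaps\<close>

text \<open>\<open>gap_start\<close> is left continuous and jumps by exactly \<open>len x\<close> at
  x, so the closed gaps, degenerate ones included, cover the line. The base point for y is the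
  supremum of all x with \<open>gap_start x \<le> y\<close>.\<close>

lemma gap_exists: "\<exists>x. gap_start x \<le> y \<and> y \<le> gap_start x + len x"
proof -
  define X where "X = {x. gap_start x \<le> y}"
  have ne: "X \<noteq> {}"
    using gap_start_int[of "\<lfloor>y\<rfloor>"] by (auto simp: X_def intro!: exI[of _ "of_int \<lfloor>y\<rfloor>"])
  have bdd: "bdd_above X"
  proof (rule bdd_aboveI)
    fix x assume "x \<in> X"
    show "x \<le> of_int (\<lfloor>y\<rfloor> + 1)"
    proof (rule ccontr)
      assume "\<not> ?thesis"
      then have "gap_start (of_int (\<lfloor>y\<rfloor> + 1)) \<le> gap_start x" by (intro gap_start_mono) auto
      then show False using \<open>x \<in> X\<close> unfolding gap_start_int X_def by simp linarith
    qed
  qed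
  define x where "x = Sup X"
  have below: "gap_start u \<le> y" if "u < x" for u
    using that ne bdd gap_start_mono unfolding x_def X_def
    by (metis (no_types, lifting) less_cSup_iff[OF ne bdd] X_def mem_Collect_eq less_imp_le order_trans)
  have above: "y < gap_start u" if "x < u" for u
    using that cSup_upper[OF _ bdd, of u] unfolding x_def X_def by (auto simp: not_le[symmetric])
  \<comment> \<open>Apart from its jump at x, \<open>gap_start\<close> varies by less than
    \<epsilon> on either side of x.\<close>
  have small: "\<exists>\<delta>>0. weight * \<delta> + mass ({x - \<delta><..<x + \<delta>} - {x}) < \<epsilon>" if \<epsilon>: "0 < \<epsilon>" for \<epsilon>
  proof -
    obtain \<delta> where \<delta>: "0 < \<delta>" "mass ({x - \<delta><..<x + \<delta>} - {x}) < \<epsilon> / 2"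
      by (rule mass_punctured_small[of "\<epsilon> / 2" x]) (use \<epsilon> in auto)
    define \<eta> where "\<eta> = min \<delta> (\<epsilon> / (2 * weight))"
    have "mass ({x - \<eta><..<x + \<eta>} - {x}) \<le> mass ({x - \<delta><..<x + \<delta>} - {x})"
      by (intro mass_mono) (auto simp: \<eta>_def intro: bounded_subset[of "{x - \<delta><..<x + \<delta>}"])
    moreover have "weight * \<eta> \<le> weight * (\<epsilon> / (2 * weight))"
      by (intro mult_left_mono) (auto simp: \<eta>_def less_imp_le)
    moreover have "weight * (\<epsilon> / (2 * weight)) = \<epsilon> / 2"
      using weight_pos by (simp add: field_simps less_imp_neq[symmetric])
    moreover have "0 < \<eta>" using \<delta> that by (simp add: \<eta>_def)
    ultimately show ?thesis using \<delta> by (intro exI[of _ \<eta>]) linarith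
  qed
  have "gap_start x \<le> y"
  proof (rule ccontr)
    assume "\<not> gap_start x \<le> y"
    then obtain \<delta> where \<delta>: "0 < \<delta>"
      "weight * \<delta> + mass ({x - \<delta><..<x + \<delta>} - {x}) < gap_start x - y"
      using small[of "gap_start x - y"] by auto
    define u where "u = x - \<delta> / 2"
    have "mass {u..<x} \<le> mass ({x - \<delta><..<x + \<delta>} - {x})"
      using \<delta> by (intro mass_mono) (auto simp: u_def intro: bounded_subset[of "{x - \<delta><..<x + \<delta>}"])
    moreover have "weight * (x - u) \<le> weight * \<delta>"
      using \<delta> by (intro mult_left_mono) (auto simp: u_def less_imp_le)
    moreover have "gap_start x = gap_start u + weight * (x - u) + mass {u..<x}"
      using \<delta> by (intro gap_start_diff) (simp add: u_def)
    moreover have "gap_start u \<le> y" using \<delta> by (intro below) (simp add: u_def)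
    ultimately show False using \<delta> by linarith
  qed
  moreover have "y \<le> gap_start x + len x"
  proof (rule ccontr)
    assume "\<not> y \<le> gap_start x + len x"
    then obtain \<delta> where \<delta>: "0 < \<delta>"
      "weight * \<delta> + mass ({x - \<delta><..<x + \<delta>} - {x}) < y - (gap_start x + len x)"
      using small[of "y - (gap_start x + len x)"] by auto
    define u where "u = x + \<delta> / 2"
    have "mass {x<..<u} \<le> mass ({x - \<delta><..<x + \<delta>} - {x})"
      using \<delta> by (intro mass_mono) (auto simp: u_def intro: bounded_subset[of "{x - \<delta><..<x + \<delta>}"])
    moreover have "weight * (u - x) \<le> weight * \<delta>"
      using \<delta> by (intro mult_left_mono) (auto simp: u_def less_imp_le)
    moreover have "gap_start u = gap_start x + len x + weight * (u - x) + mass {x<..<u}"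
      using \<delta> by (intro gap_start_less) (simp add: u_def)
    moreover have "y < gap_start u" using \<delta> by (intro above) (simp add: u_def)
    ultimately show False using \<delta> by linarith
  qed
  ultimately show ?thesis by blast
qed

text \<open>The Denjoy semiconjugacy, shrinking every gap to its base point. The choice is unique by
  \<open>collapse_eq\<close>.\<close>

definition collapse :: "real \<Rightarrow> real" where
  "collapse y = (SOME x. gap_start x \<le> y \<and> y \<le> gap_start x + len x)"

lemma collapse_bounds: "gap_start (collapse y) \<le> y" "y \<le> gap_start (collapse y) + len (collapse y)"
  using someI_ex[OF gap_exists[of y]] unfolding collapse_def by auto

lemma collapse_eq:
  assumes "gap_start x \<le> y" "y \<le> gap_start x + len x"
  shows "collapse y = x"
  using collapse_bounds[of y] assms gap_start_strict[of x "collapse y"] gap_start_strict[of "collapse y" x]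
  by (cases x "collapse y" rule: linorder_cases) auto

lemma collapse_add_1: "collapse (y + 1) = collapse y + 1"
  using collapse_bounds[of y] by (intro collapse_eq) (auto simp: gap_start_add_1)

text \<open>\<open>gap_start\<close> fixes the integers, so y and \<open>collapse y\<close> lie in
  the same interval [k, k + 1).\<close>

lemma collapse_close: "\<bar>y - collapse y\<bar> \<le> 1"
proof -
  let ?x = "collapse y"
  have "gap_start (of_int \<lfloor>?x\<rfloor>) \<le> gap_start ?x" by (rule gap_start_mono) simp
  moreover have "gap_start ?x + len ?x < gap_start (of_int (\<lfloor>?x\<rfloor> + 1))"
    by (rule gap_start_strict) linarith
  ultimately have "of_int \<lfloor>?x\<rfloor> \<le> y" "y < of_int (\<lfloor>?x\<rfloor> + 1)"
    using collapse_bounds[of y] unfolding gap_start_int by auto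
  then show ?thesis by linarith
qed

end

section \<open>Lifting translations to the blown-up line\<close>

lemma taylor_has_real_derivative:
  fixes f g :: "real \<Rightarrow> real"
  assumes taylor: "\<And>x y. \<bar>f y - f x - g x * (y - x)\<bar> \<le> L * \<bar>y - x\<bar> powr (1 + \<tau>)"
    and "0 < \<tau>"
  shows "(f has_real_derivative g x) (at x)"
proof -
  have "((\<lambda>h. (f (x + h) - f x) / h - g x) \<longlongrightarrow> 0) (at 0)"
  proof (rule tendsto_0_le[where K = 1])
    show "((\<lambda>h. L * \<bar>h\<bar> powr \<tau>) \<longlongrightarrow> 0) (at 0)"
      using assms(2) by (auto intro!: tendsto_eq_intros)
    have "\<bar>(f (x + h) - f x) / h - g x\<bar> \<le> \<bar>L * \<bar>h\<bar> powr \<tau>\<bar>" if "h \<noteq> 0" for h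
    proof -
      have "(f (x + h) - f x) / h - g x = (f (x + h) - f x - g x * h) / h"
        using that by (simp add: field_simps)
      then have "\<bar>(f (x + h) - f x) / h - g x\<bar> = \<bar>f (x + h) - f x - g x * h\<bar> / \<bar>h\<bar>"
        by simp
      also have "\<dots> \<le> (L * \<bar>h\<bar> powr (1 + \<tau>)) / \<bar>h\<bar>"
        using taylor[of "x + h" x] by (intro divide_right_mono) auto
      also have "\<dots> = L * \<bar>h\<bar> powr \<tau>" using that by (simp add: powr_add)
      finally show ?thesis by linarith
    qed
    then show "\<forall>\<^sub>F h in at 0. norm ((f (x + h) - f x) / h - g x) \<le> norm (L * \<bar>h\<bar> powr \<tau>) * 1"
      by (auto simp: eventually_at_filter)
  qed
  then show ?thesis by (simp add: DERIV_def LIM_zero_iff)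
qed

text \<open>Adding the estimates based at x and at y cancels the values of f and leaves (g x - g
  y)(y - x).\<close>

lemma taylor_holder:
  fixes f g :: "real \<Rightarrow> real"
  assumes taylor: "\<And>x y. \<bar>f y - f x - g x * (y - x)\<bar> \<le> L * \<bar>y - x\<bar> powr (1 + \<tau>)"
  shows "\<bar>g x - g y\<bar> \<le> 2 * L * \<bar>x - y\<bar> powr \<tau>"
proof (cases "x = y")
  case False
  have "\<bar>(g x - g y) * (y - x)\<bar> \<le> 2 * L * \<bar>x - y\<bar> powr (1 + \<tau>)"
    using taylor[of y x] taylor[of x y] by (simp add: abs_minus_commute algebra_simps abs_le_iff)
  then have "\<bar>g x - g y\<bar> * \<bar>x - y\<bar> \<le> (2 * L * \<bar>x - y\<bar> powr \<tau>) * \<bar>x - y\<bar>"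
    using False by (simp add: abs_mult abs_minus_commute powr_add mult_ac)
  then show ?thesis using False by (simp add: mult_le_cancel_right)
qed simp

lemma holder_continuous:
  fixes g :: "real \<Rightarrow> real"
  assumes holder: "\<And>x y. \<bar>g x - g y\<bar> \<le> C * \<bar>x - y\<bar> powr \<tau>" and "0 < \<tau>"
  shows "continuous_on UNIV g"
proof (rule continuous_at_imp_continuous_on, rule ballI)
  fix x
  have "((\<lambda>y. g y - g x) \<longlongrightarrow> 0) (at x)"
  proof (rule tendsto_0_le[where K = 1])
    show "((\<lambda>y. C * \<bar>y - x\<bar> powr \<tau>) \<longlongrightarrow> 0) (at x)"
      using assms(2) by (auto intro!: tendsto_eq_intros)
    show "\<forall>\<^sub>F y in at x. norm (g y - g x) \<le> norm (C * \<bar>y - x\<bar> powr \<tau>) * 1"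
    proof (rule always_eventually, rule allI)
      fix y
      show "norm (g y - g x) \<le> norm (C * \<bar>y - x\<bar> powr \<tau>) * 1"
        using holder[of y x] unfolding real_norm_def by linarith
    qed
  qed
  then show "isCont g x" by (simp add: isCont_def LIM_zero_iff)
qed

context gap_lengths
begin

section \<open>The action of translations on the blown-up line\<close>

text \<open>The formula also covers degenerate gaps: there the offset from \<open>gap_start\<close>
  is 0 and so is the Yoccoz term.\<close>

definition lift :: "real \<Rightarrow> real \<Rightarrow> real" where
  "lift r y = gap_start (collapse y + r) +
     yoccoz (len (collapse y)) (len (collapse y + r)) (y - gap_start (collapse y))"

definition lift_deriv :: "real \<Rightarrow> real \<Rightarrow> real" where
  "lift_deriv r y = yoccoz_deriv (len (collapse y)) (len (collapse y + r)) (y - gap_start (collapse y))"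

text \<open>Excludes matching a degenerate gap with a nondegenerate one, between which no Yoccoz
  diffeomorphism exists.\<close>

definition gap_invariant :: "real \<Rightarrow> bool" where
  "gap_invariant r \<longleftrightarrow> (\<forall>x. len (x + r) = 0 \<longleftrightarrow> len x = 0)"

lemma lift_gap:
  assumes "0 \<le> t" "t \<le> len x"
  shows "lift r (gap_start x + t) = gap_start (x + r) + yoccoz (len x) (len (x + r)) t"
  using assms collapse_eq[of x "gap_start x + t"] by (simp add: lift_def)

lemma lift_bounds:
  assumes "gap_invariant r"
  shows "gap_start (collapse y + r) \<le> lift r y"
    "lift r y \<le> gap_start (collapse y + r) + len (collapse y + r)"
  using assms collapse_bounds[of y]
    yoccoz_range[of "len (collapse y)" "len (collapse y + r)" "y - gap_start (collapse y)"]
  by (auto simp: lift_def gap_invariant_def)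

lemma collapse_lift:
  assumes "gap_invariant r"
  shows "collapse (lift r y) = collapse y + r"
  using lift_bounds[OF assms] by (intro collapse_eq)

text \<open>Base points add and the Yoccoz maps satisfy the cocycle identity, so the lifts form an
  action of translations. Commutation is then that of addition.\<close>

lemma lift_lift:
  assumes "gap_invariant r" "gap_invariant q"
  shows "lift q (lift r y) = lift (r + q) y"
proof -
  let ?x = "collapse y"
  let ?t = "y - gap_start ?x"
  have "yoccoz (len (?x + r)) (len (?x + r + q)) (yoccoz (len ?x) (len (?x + r)) ?t) =
      yoccoz (len ?x) (len (?x + r + q)) ?t"
  proof (cases "len ?x = 0")
    case True
    then have "?t = 0" using collapse_bounds[of y] by simp
    then show ?thesis by simp
  next
    case False
    then have "len (?x + r) \<noteq> 0" "len (?x + r + q) \<noteq> 0"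
      using assms by (auto simp: gap_invariant_def)
    then show ?thesis using False len_nonneg by (intro yoccoz_compose) (auto simp: less_le)
  qed
  moreover have "lift q (lift r y) = gap_start (?x + r + q) +
      yoccoz (len (?x + r)) (len (?x + r + q)) (lift r y - gap_start (?x + r))"
    unfolding lift_def[of q "lift r y"] collapse_lift[OF assms(1)] ..
  ultimately show ?thesis by (simp add: lift_def add.assoc)
qed

lemma lift_commute:
  assumes "gap_invariant r" "gap_invariant q"
  shows "lift q (lift r y) = lift r (lift q y)"
  using lift_lift[OF assms] lift_lift[OF assms(2,1)] by (simp add: add.commute)

lemma lift_add_1: "lift r (y + 1) = lift r y + 1"
proof -
  have "collapse y + 1 + r = collapse y + r + 1" by simp
  then have "gap_start (collapse y + 1 + r) = gap_start (collapse y + r) + 1"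
    "len (collapse y + 1 + r) = len (collapse y + r)"
    by (simp_all only: gap_start_add_1 len_periodic)
  then show ?thesis
    by (simp add: lift_def collapse_add_1 gap_start_add_1)
qed

lemma collapse_lift_funpow:
  assumes "gap_invariant r"
  shows "collapse ((lift r ^^ n) y) = collapse y + real n * r"
  by (induction n) (simp_all add: collapse_lift[OF assms] algebra_simps)

text \<open>\<open>collapse\<close> turns n iterations into adding n r and moves no point by more
  than 1, so the n-th displacement stays within 2 of n r.\<close>

lemma lift_rotation_number:
  assumes "gap_invariant r"
  shows "has_rotation_number (lift r) r"
proof -
  have "(\<lambda>n. ((lift r ^^ n) y - y) / real n) \<longlonglongrightarrow> r + 0" for y
  proof -
    have "(\<lambda>n. ((lift r ^^ n) y - y) / real n - r) \<longlonglongrightarrow> 0"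
    proof (rule tendsto_0_le[where K = 2])
      show "(\<lambda>n. 1 / real n) \<longlonglongrightarrow> 0" by (rule lim_1_over_n)
      have "\<bar>((lift r ^^ n) y - y) / real n - r\<bar> \<le> 1 / real n * 2" if "n > 0" for n
      proof -
        have "((lift r ^^ n) y - y) / real n - r = ((lift r ^^ n) y - y - real n * r) / real n"
          using that by (simp add: field_simps)
        moreover have "\<bar>(lift r ^^ n) y - y - real n * r\<bar> \<le> 2"
          using collapse_close[of y] collapse_close[of "(lift r ^^ n) y"]
          unfolding collapse_lift_funpow[OF assms] by linarith
        ultimately show ?thesis using that by (simp add: field_simps)
      qed
      then show "\<forall>\<^sub>F n in sequentially. norm (((lift r ^^ n) y - y) / real n - r) \<le> norm (1 / real n) * 2"
        by (auto intro: eventually_mono[OF eventually_gt_at_top[of 0]])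
    qed
    then show ?thesis by (simp add: LIM_zero_iff)
  qed
  then show ?thesis unfolding has_rotation_number_def by (intro bexI[of _ 0]) auto
qed

lemma lift_deriv_pos:
  assumes "gap_invariant r"
  shows "0 < lift_deriv r y"
  using assms unfolding lift_deriv_def gap_invariant_def by (intro yoccoz_deriv_pos) auto

section \<open>Regularity of the lifts\<close>

text \<open>For lengths l <= D one has l^(1 + \<tau>) <= D^\<tau> l, so translation changes each
  length by a relative error of at most C D^\<tau>, and this sums.\<close>

lemma mass_translation_bound:
  assumes I: "bounded I"
    and C: "\<And>x. \<bar>len (x + r) - len x\<bar> \<le> C * len x powr (1 + \<tau>)" and "0 \<le> C" "0 < \<tau>"
    and D: "\<And>x. x \<in> I \<Longrightarrow> len x \<le> D"
  shows "\<bar>mass ((\<lambda>x. x + r) ` I) - mass I\<bar> \<le> C * D powr \<tau> * mass I"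
proof -
  define E where "E = C * D powr \<tau>"
  have E: "\<bar>len (x + r) - len x\<bar> \<le> E * len x" if "x \<in> I" for x
  proof -
    have "C * len x powr (1 + \<tau>) = C * len x powr \<tau> * len x" by (simp add: powr_add)
    also have "\<dots> \<le> E * len x"
      unfolding E_def using assms D[OF that] by (intro mult_right_mono mult_left_mono powr_mono2) auto
    finally show ?thesis using C[of x] by linarith
  qed
  have sI: "len summable_on I" by (rule summable_bounded[OF I])
  have "bounded ((\<lambda>x. x + r) ` I)" using bounded_translation[OF I, of r] by (simp add: add.commute)
  from summable_bounded[OF this] have s: "(\<lambda>x. len (x + r)) summable_on I"
    by (simp add: summable_on_reindex inj_on_def o_def)
  have m: "mass ((\<lambda>x. x + r) ` I) = (\<Sum>\<^sub>\<infinity>x\<in>I. len (x + r))"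
    by (subst infsum_reindex) (auto simp: inj_on_def o_def)
  have "(\<Sum>\<^sub>\<infinity>x\<in>I. len (x + r)) \<le> (\<Sum>\<^sub>\<infinity>x\<in>I. (1 + E) * len x)"
    using E by (intro infsum_mono s summable_on_cmult_right sI) (fastforce simp: algebra_simps abs_le_iff)
  moreover have "(\<Sum>\<^sub>\<infinity>x\<in>I. (1 - E) * len x) \<le> (\<Sum>\<^sub>\<infinity>x\<in>I. len (x + r))"
    using E by (intro infsum_mono s summable_on_cmult_right sI) (fastforce simp: algebra_simps abs_le_iff)
  ultimately show ?thesis
    unfolding m infsum_cmult_right' E_def[symmetric] by (simp add: algebra_simps abs_le_iff)
qed

text \<open>Within one gap this is the Taylor estimate of the Yoccoz map. Across gaps, with K = C (1
  + M) M^6 pi, the error is C for the intermediate gaps, K for each of the two partial end gaps, and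
  K for replacing the derivative by 1.\<close>

lemma lift_taylor:
  assumes M: "1 \<le> M" "\<And>x. len (x + r) \<le> M * len x" "\<And>x. len x \<le> M * len (x + r)"
    and C: "\<And>x. \<bar>len (x + r) - len x\<bar> \<le> C * len x powr (1 + \<tau>)" and C0: "0 \<le> C"
    and \<tau>: "0 < \<tau>" "\<tau> < 1"
  shows "\<bar>lift r z - lift r y - lift_deriv r y * (z - y)\<bar>
      \<le> (C + 3 * (C * (1 + M) * M ^ 6 * pi)) * \<bar>z - y\<bar> powr (1 + \<tau>)"
proof -
  define K where "K = C * (1 + M) * M ^ 6 * pi"
  have K0: "0 \<le> K" using C0 M by (simp add: K_def)
  have len_0: "len (x + r) = 0 \<longleftrightarrow> len x = 0" for x
    using M(2)[of x] M(3)[of x] by (auto intro!: order_antisym)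
  define \<phi> where "\<phi> x = yoccoz (len x) (len (x + r))" for x
  define \<phi>' where "\<phi>' x = yoccoz_deriv (len x) (len (x + r))" for x
  have pos: "0 < len x" "0 < len (x + r)" if "len x \<noteq> 0" for x
    using that len_0[of x] len_nonneg[of x] len_nonneg[of "x + r"] by (auto simp: less_le)
  have taylor: "\<bar>\<phi> x t - \<phi> x s - \<phi>' x s * (t - s)\<bar> \<le> K * \<bar>t - s\<bar> powr (1 + \<tau>)"
    if "s \<in> {0..len x}" "t \<in> {0..len x}" for x s t
  proof (cases "len x = 0")
    case False
    then show ?thesis
      unfolding \<phi>_def \<phi>'_def K_def using that by (intro yoccoz_taylor pos M C \<tau>) auto
  qed (use that in auto)
  have holder: "\<bar>\<phi>' x t - \<phi>' x s\<bar> \<le> K * \<bar>t - s\<bar> powr \<tau>"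
    if "s \<in> {0..len x}" "t \<in> {0..len x}" for x s t
  proof (cases "len x = 0")
    case False
    then show ?thesis
      unfolding \<phi>'_def K_def using that by (intro yoccoz_deriv_holder pos M C \<tau>) auto
  qed (use that in auto)
  have ends: "\<phi> x 0 = 0" "\<phi> x (len x) = len (x + r)" "\<phi>' x 0 = 1" "\<phi>' x (len x) = 1" for x
    using len_0[of x] by (auto simp: \<phi>_def \<phi>'_def yoccoz_end)
  \<comment> \<open>Two points in different gaps are separated by whole gaps, and on the separating piece
      the lift is an isometry up to the total change of the gap lengths.\<close>
  have far: "\<bar>lift r z - lift r y - (z - y)\<bar> \<le> (C + 2 * K) * (z - y) powr (1 + \<tau>) \<and>
      \<bar>lift_deriv r y - 1\<bar> \<le> K * (z - y) powr \<tau> \<and> \<bar>lift_deriv r z - 1\<bar> \<le> K * (z - y) powr \<tau> \<and> y < z"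
    if less: "collapse y < collapse z" for y z
  proof -
    let ?u = "collapse y" and ?v = "collapse z"
    define s where "s = y - gap_start ?u"
    define t where "t = z - gap_start ?v"
    have s: "s \<in> {0..len ?u}" and t: "t \<in> {0..len ?v}"
      using collapse_bounds[of y] collapse_bounds[of z] by (auto simp: s_def t_def)
    define I where "I = {?u<..<?v}"
    have I: "bounded I" by (simp add: I_def)
    \<comment> \<open>From y to z: the rest of the gap of y, the intermediate part, the beginning of
      the gap of z. The lift preserves the \<open>weight\<close> term, since translation preserves
      \<open>?v - ?u\<close>.\<close>
    have eq1: "z - y = t + weight * (?v - ?u) + mass I + (len ?u - s)"
      using gap_start_less[OF less] by (simp add: s_def t_def I_def)
    have "{?u + r<..<?v + r} = (\<lambda>x. x + r) ` I"
      unfolding I_def by (auto simp: image_iff intro!: bexI[of _ "_ - r"])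
    then have eq2: "lift r z - lift r y = \<phi> ?v t + weight * (?v - ?u) + mass ((\<lambda>x. x + r) ` I)
        + (len (?u + r) - \<phi> ?u s)"
      using gap_start_less[of "?u + r" "?v + r"] less by (simp add: lift_def s_def t_def \<phi>_def)
    have w: "0 < weight * (?v - ?u)" using less by simp
    have le: "t \<le> z - y" "mass I \<le> z - y" "len ?u - s \<le> z - y" "0 < z - y"
      using eq1 w s t mass_nonneg[of I] unfolding atLeastAtMost_iff by linarith+
    \<comment> \<open>Intermediate gaps lie between y and z, which gives D = z - y in the bound on
      the mass.\<close>
    have "len x \<le> z - y" if "x \<in> I" for x
      using mass_mono[of "{x}" I] that I le by auto
    from mass_translation_bound[OF I C C0 \<tau>(1) this]
    have "\<bar>mass ((\<lambda>x. x + r) ` I) - mass I\<bar> \<le> C * (z - y) powr \<tau> * mass I" .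
    also have "\<dots> \<le> C * (z - y) powr \<tau> * (z - y)" using C0 le by (intro mult_left_mono) auto
    also have "\<dots> = C * (z - y) powr (1 + \<tau>)" using le by (simp add: powr_add)
    finally have mid: "\<bar>mass ((\<lambda>x. x + r) ` I) - mass I\<bar> \<le> C * (z - y) powr (1 + \<tau>)" .
    have "\<bar>\<phi> ?v t - t\<bar> \<le> K * \<bar>t\<bar> powr (1 + \<tau>)"
      using taylor[of 0 ?v t] t ends[of ?v] by simp
    also have "\<dots> \<le> K * (z - y) powr (1 + \<tau>)"
      using K0 t le \<tau> by (intro mult_left_mono powr_mono2) auto
    finally have right: "\<bar>\<phi> ?v t - t\<bar> \<le> K * (z - y) powr (1 + \<tau>)" .
    \<comment> \<open>The expansion is based at the right end of the gap, where the derivative is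
      1.\<close>
    have "\<bar>(len (?u + r) - \<phi> ?u s) - (len ?u - s)\<bar> \<le> K * \<bar>len ?u - s\<bar> powr (1 + \<tau>)"
      using taylor[of "len ?u" ?u s] s ends[of ?u]
      by (simp add: abs_minus_commute)
    also have "\<dots> \<le> K * (z - y) powr (1 + \<tau>)"
      using K0 s le \<tau> by (intro mult_left_mono powr_mono2) auto
    finally have left: "\<bar>(len (?u + r) - \<phi> ?u s) - (len ?u - s)\<bar> \<le> K * (z - y) powr (1 + \<tau>)" .
    have "\<bar>lift r z - lift r y - (z - y)\<bar> \<le> (C + 2 * K) * (z - y) powr (1 + \<tau>)"
      using left right mid eq1 eq2 unfolding distrib_right mult.assoc by linarith
    moreover have "\<bar>lift_deriv r y - 1\<bar> \<le> K * (z - y) powr \<tau>"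
    proof -
      have "\<bar>\<phi>' ?u s - 1\<bar> \<le> K * \<bar>s - len ?u\<bar> powr \<tau>"
        using holder[of "len ?u" ?u s] s ends[of ?u] by simp
      also have "\<dots> \<le> K * (z - y) powr \<tau>"
        using K0 s le \<tau> by (intro mult_left_mono powr_mono2) auto
      finally show ?thesis by (simp add: lift_deriv_def \<phi>'_def s_def)
    qed
    moreover have "\<bar>lift_deriv r z - 1\<bar> \<le> K * (z - y) powr \<tau>"
    proof -
      have "\<bar>\<phi>' ?v t - 1\<bar> \<le> K * \<bar>t\<bar> powr \<tau>"
        using holder[of 0 ?v t] t ends[of ?v] by simp
      also have "\<dots> \<le> K * (z - y) powr \<tau>"
        using K0 t le \<tau> by (intro mult_left_mono powr_mono2) auto
      finally show ?thesis by (simp add: lift_deriv_def \<phi>'_def t_def)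
    qed
    ultimately show ?thesis using le by simp
  qed
  have combine: "\<bar>\<Delta> - g * h\<bar> \<le> (C + 3 * K) * \<bar>h\<bar> powr (1 + \<tau>)"
    if "\<bar>\<Delta> - h\<bar> \<le> (C + 2 * K) * \<bar>h\<bar> powr (1 + \<tau>)" "\<bar>g - 1\<bar> \<le> K * \<bar>h\<bar> powr \<tau>" for \<Delta> g h
  proof -
    have "\<bar>g - 1\<bar> * \<bar>h\<bar> \<le> K * \<bar>h\<bar> powr \<tau> * \<bar>h\<bar>" using that by (intro mult_right_mono) auto
    then have "\<bar>(g - 1) * h\<bar> \<le> K * \<bar>h\<bar> powr (1 + \<tau>)" by (simp add: powr_add abs_mult mult_ac)
    moreover have "\<Delta> - g * h = (\<Delta> - h) - (g - 1) * h" by (simp add: algebra_simps)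
    ultimately show ?thesis using that(1) by (simp add: distrib_right)
  qed
  consider "collapse y = collapse z" | "collapse y < collapse z" | "collapse z < collapse y" by linarith
  then have "\<bar>lift r z - lift r y - lift_deriv r y * (z - y)\<bar> \<le> (C + 3 * K) * \<bar>z - y\<bar> powr (1 + \<tau>)"
  proof cases
    case 1
    let ?u = "collapse y"
    have "\<bar>\<phi> ?u (z - gap_start ?u) - \<phi> ?u (y - gap_start ?u) - \<phi>' ?u (y - gap_start ?u) * (z - y)\<bar>
        \<le> K * \<bar>z - y\<bar> powr (1 + \<tau>)"
      using taylor[of "y - gap_start ?u" ?u "z - gap_start ?u"] collapse_bounds[of y] collapse_bounds[of z] 1
      by simp
    also have "\<dots> \<le> (C + 3 * K) * \<bar>z - y\<bar> powr (1 + \<tau>)"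
      using C0 K0 by (intro mult_right_mono) auto
    finally show ?thesis using 1 by (simp add: lift_def lift_deriv_def \<phi>_def \<phi>'_def)
  next
    case 2
    show ?thesis using far[OF 2] by (intro combine) auto
  next
    case 3
    show ?thesis using far[OF 3] by (intro combine) (auto simp: abs_minus_commute)
  qed
  then show ?thesis unfolding K_def .
qed

section \<open>Absence of a conjugacy to a rotation\<close>

text \<open>Irrationality makes the orbit points distinct modulo 1, and infinitely many gaps of
  length at least \<delta> would exceed the finite total in one period.\<close>

lemma orbit_gaps_arbitrarily_short:
  assumes "r \<notin> \<rat>" "0 < \<delta>"
  shows "\<exists>n. len (x + real n * r) < \<delta>"
proof (rule ccontr)
  assume "\<not> ?thesis"
  then have big: "\<delta> \<le> len (x + real n * r)" for n by (simp add: not_less)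
  define p where "p n = frac (x + real n * r)" for n
  have "inj p"
  proof (rule injI, rule ccontr)
    fix m n assume "p m = p n" "m \<noteq> n"
    define k where "k = \<lfloor>x + real m * r\<rfloor> - \<lfloor>x + real n * r\<rfloor>"
    have "real m * r - real n * r = of_int k"
      using \<open>p m = p n\<close> unfolding p_def frac_def k_def of_int_diff by linarith
    then have "(real m - real n) * r = of_int k" by (simp add: left_diff_distrib)
    then have "r = of_int k / (real m - real n)" using \<open>m \<noteq> n\<close> by (simp add: eq_divide_eq mult.commute)
    then show False using assms(1) by simp
  qed
  then have inf: "infinite (range p)" by (rule range_inj_infinite)
  obtain N :: nat where N: "mass {0..<1} < real N * \<delta>"
    using reals_Archimedean3[OF assms(2)] by blast
  obtain B where B: "B \<subseteq> range p" "finite B" "card B = N"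
    using infinite_arbitrarily_large[OF inf] by blast
  have len_p: "len (p n) = len (x + real n * r)" for n
    using len_add_int[of "p n" "\<lfloor>x + real n * r\<rfloor>"] by (simp add: p_def frac_def)
  have "real N * \<delta> \<le> sum len B"
    unfolding B(3)[symmetric] using B(1) len_p big by (intro sum_bounded_below) auto
  also have "\<dots> \<le> mass {0..<1}"
    using B len_summable by (intro finite_sum_le_infsum) (auto simp: p_def frac_lt_1)
  finally show False using N by simp
qed

text \<open>A conjugacy G carries the iterates of a gap to translates of a single nondegenerate
  interval. Since some iterate is arbitrarily short, this contradicts uniform continuity of
  G.\<close>

lemma lift_not_conj_to_rotation:
  assumes inv: "gap_invariant r" and r: "r \<notin> \<rat>" and cont: "continuous_on UNIV (lift r)" and x: "0 < len x"
  shows "\<not> conj_to_rotation (lift r)"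
proof
  assume "conj_to_rotation (lift r)"
  then obtain G \<alpha> where G: "circle_homeo G" and conj: "\<And>y. G (lift r y) - (G y + \<alpha>) \<in> \<int>"
    by (auto simp: conj_to_rotation_def)
  have contG: "continuous_on UNIV G" and inj: "inj G" using G by (auto simp: circle_homeo_def)
  \<comment> \<open>The sign e covers both orientations of G.\<close>
  obtain e :: int where e: "\<And>y. G (y + 1) = G y + of_int e"
  proof (cases "\<forall>y. G (y + 1) = G y + 1")
    case True
    then show ?thesis using that[of 1] by simp
  next
    case False
    then show ?thesis using G that[of "-1"] unfolding circle_homeo_def by auto
  qed
  have e_int: "G (y + of_int n) = G y + of_int (n * e)" for y n
  proof (induction n arbitrary: y rule: int_induct[of _ 0])
    case (step1 i)
    have "G (y + of_int (i + 1)) = G (y + of_int i) + of_int e"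
      using e[of "y + of_int i"] by (simp add: add.assoc)
    then show ?case using step1(2)[of y] by (simp add: algebra_simps)
  next
    case (step2 i)
    have "G (y + of_int i) = G (y + of_int (i - 1)) + of_int e"
      using e[of "y + of_int (i - 1)"] by simp
    then show ?case using step2(2)[of y] by (simp add: algebra_simps)
  qed simp
  \<comment> \<open>A continuous function with integer values is constant, so the relation modulo 1
    becomes an exact one that can be iterated.\<close>
  have "(\<lambda>y. G (lift r y) - (G y + \<alpha>)) constant_on UNIV"
  proof (rule continuous_discrete_range_constant)
    show "continuous_on UNIV (\<lambda>y. G (lift r y) - (G y + \<alpha>))"
      by (intro continuous_intros contG continuous_on_compose2[OF contG cont]) auto
    fix y :: real
    show "\<exists>e>0. \<forall>z. z \<in> UNIV \<and> G (lift r z) - (G z + \<alpha>) \<noteq> G (lift r y) - (G y + \<alpha>) \<longrightarrow>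
        e \<le> norm (G (lift r z) - (G z + \<alpha>) - (G (lift r y) - (G y + \<alpha>)))"
    proof (intro exI[of _ 1] conjI allI impI)
      fix z assume z: "z \<in> UNIV \<and> G (lift r z) - (G z + \<alpha>) \<noteq> G (lift r y) - (G y + \<alpha>)"
      have "G (lift r z) - (G z + \<alpha>) - (G (lift r y) - (G y + \<alpha>)) \<in> \<int>"
        by (rule Ints_diff[OF conj conj])
      then show "1 \<le> norm (G (lift r z) - (G z + \<alpha>) - (G (lift r y) - (G y + \<alpha>)))"
        using z Ints_nonzero_abs_ge1 by fastforce
    qed simp
  qed simp
  then obtain c where c: "\<And>y. G (lift r y) - (G y + \<alpha>) = c" by (auto simp: constant_on_def)
  have iter: "G ((lift r ^^ n) y) = G y + real n * (\<alpha> + c)" for n y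
  proof (induction n)
    case (Suc n)
    then show ?case using c[of "(lift r ^^ n) y"] by (simp add: algebra_simps)
  qed simp
  define a where "a = gap_start x"
  define b where "b = gap_start x + len x"
  have left: "(lift r ^^ n) a = gap_start (x + real n * r)" for n
  proof (induction n)
    case (Suc n)
    have "lift r (gap_start (x + real n * r) + 0) = gap_start (x + real n * r + r) + 0"
      by (subst lift_gap) auto
    then show ?case using Suc by (simp add: algebra_simps)
  qed (simp add: a_def)
  have right: "(lift r ^^ n) b = gap_start (x + real n * r) + len (x + real n * r)" for n
  proof (induction n)
    case (Suc n)
    have "lift r (gap_start (x + real n * r) + len (x + real n * r)) =
        gap_start (x + real n * r + r) + len (x + real n * r + r)"
      using inv by (subst lift_gap) (auto simp: yoccoz_end gap_invariant_def)
    then show ?case using Suc by (simp add: algebra_simps)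
  qed (simp add: b_def)
  define \<epsilon> where "\<epsilon> = \<bar>G b - G a\<bar>"
  have "G b \<noteq> G a" using inj x by (auto simp: inj_eq a_def b_def)
  then have "0 < \<epsilon>" by (simp add: \<epsilon>_def)
  \<comment> \<open>An integer shift brings the left end of a gap into [0, 1). A gap shorter than 1
    then lies in [0, 2].\<close>
  have "uniformly_continuous_on {0..2} G"
    using contG by (intro compact_uniformly_continuous) (auto intro: continuous_on_subset)
  then obtain \<delta> where \<delta>: "0 < \<delta>"
    "\<And>u v. u \<in> {0..2} \<Longrightarrow> v \<in> {0..2} \<Longrightarrow> dist v u < \<delta> \<Longrightarrow> dist (G v) (G u) < \<epsilon>"
    unfolding uniformly_continuous_on_def using \<open>0 < \<epsilon>\<close> by blast
  obtain n where n: "len (x + real n * r) < min \<delta> 1"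
    using orbit_gaps_arbitrarily_short[OF r, of "min \<delta> 1" x] \<delta>(1) by auto
  let ?u = "(lift r ^^ n) a" and ?v = "(lift r ^^ n) b"
  have uv: "?u \<le> ?v" "?v - ?u < \<delta>" "?v - ?u < 1" using n len_nonneg[of "x + real n * r"] unfolding left right by auto
  define m where "m = \<lfloor>?u\<rfloor>"
  have "of_int m \<le> ?u" "?u < of_int m + 1" unfolding m_def by linarith+
  then have "dist (G (?v + of_int (- m))) (G (?u + of_int (- m))) < \<epsilon>"
    using uv by (intro \<delta>(2)) (auto simp: dist_real_def)
  then show False unfolding e_int iter by (simp add: \<epsilon>_def dist_real_def)
qed

lemma lift_regular:
  assumes M: "1 \<le> M" "\<And>x. len (x + r) \<le> M * len x" "\<And>x. len x \<le> M * len (x + r)"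
    and C: "\<And>x. \<bar>len (x + r) - len x\<bar> \<le> C * len x powr (1 + \<tau>)" and C0: "0 \<le> C"
    and \<tau>: "0 < \<tau>" "\<tau> < 1"
  shows "gap_invariant r" "circle_diffeo (lift r)" "C1_holder \<tau> (lift r)"
proof -
  note taylor = lift_taylor[OF M C C0 \<tau>]
  note deriv = taylor_has_real_derivative[OF taylor \<tau>(1)]
  note holder = taylor_holder[OF taylor]
  show inv: "gap_invariant r"
    unfolding gap_invariant_def
    using M by (metis len_nonneg mult_zero_right order_antisym)
  show "circle_diffeo (lift r)"
    unfolding circle_diffeo_def
    using lift_add_1 deriv holder_continuous[OF holder \<tau>(1)] lift_deriv_pos[OF inv] by blast
  show "C1_holder \<tau> (lift r)"
    unfolding C1_holder_def using deriv holder by blast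
qed

end

section \<open>The lengths of the gaps\<close>

lemma powr_diff_le:
  fixes x y p :: real
  assumes "0 < x" "x \<le> y" "1 \<le> p"
  shows "y powr p - x powr p \<le> p * y powr (p - 1) * (y - x)"
proof (cases "x = y")
  case False
  have "\<exists>z>x. z < y \<and> y powr p - x powr p = (y - x) * (p * z powr (p - 1))"
    using assms False by (intro MVT2) (auto intro!: has_real_derivative_powr)
  then obtain z where z: "x < z" "z < y" "y powr p - x powr p = (y - x) * (p * z powr (p - 1))" by blast
  have "(y - x) * (p * z powr (p - 1)) \<le> (y - x) * (p * y powr (p - 1))"
    using z assms by (intro mult_left_mono powr_mono2) auto
  then show ?thesis using z by (simp add: mult_ac)
qed simp

lemma inverse_powr_perturb:
  fixes u v A \<tau> :: real
  assumes uv: "1 \<le> u" "1 \<le> v" "\<bar>u - v\<bar> \<le> 1" and A: "0 \<le> A" and \<tau>: "0 < \<tau>" "\<tau> < 1"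
  defines "N \<equiv> u powr (1 / \<tau>) + A" and "N' \<equiv> v powr (1 / \<tau>) + A" and "M \<equiv> 2 powr (1 / \<tau>)"
  shows "1 / N' \<le> M * (1 / N)" "\<bar>1 / N' - 1 / N\<bar> \<le> M\<^sup>2 / \<tau> * (1 / N) powr (1 + \<tau>)"
proof -
  define p where "p = 1 / \<tau>"
  have p: "1 \<le> p" using \<tau> by (simp add: p_def)
  have M1: "1 \<le> M" using p unfolding M_def p_def[symmetric] by (intro ge_one_powr_ge_zero) auto
  have up: "1 \<le> u powr p" "1 \<le> v powr p" using uv p by (auto intro!: ge_one_powr_ge_zero)
  have N: "1 \<le> N" "1 \<le> N'" using up A by (auto simp: N_def N'_def p_def)
  \<comment> \<open>Since v >= 1, one has u <= v + 1 <= 2 v.\<close>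
  have "u powr p \<le> (2 * v) powr p" using uv p by (intro powr_mono2) auto
  also have "\<dots> = M * v powr p" using uv by (simp add: powr_mult M_def p_def)
  finally have "N \<le> M * v powr p + 1 * A" by (simp add: N_def p_def)
  also have "\<dots> \<le> M * v powr p + M * A" using A M1 by (intro add_left_mono mult_right_mono)
  also have "\<dots> = M * N'" by (simp add: N'_def p_def distrib_left)
  finally have NN: "N \<le> M * N'" .
  then show 1: "1 / N' \<le> M * (1 / N)" using N by (simp add: field_simps)
  have upper: "\<bar>N - N'\<bar> \<le> p * (max u v) powr (p - 1)"
  proof (cases "u \<le> v")
    case True
    have "v powr p - u powr p \<le> p * v powr (p - 1) * (v - u)"
      using True uv p by (intro powr_diff_le) auto
    also have "\<dots> \<le> p * v powr (p - 1) * 1" using uv p by (intro mult_left_mono) auto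
    finally show ?thesis
      using True powr_mono2[of p u v] p uv by (simp add: N_def N'_def p_def[symmetric] max_def)
  next
    case False
    have "u powr p - v powr p \<le> p * u powr (p - 1) * (u - v)"
      using False uv p by (intro powr_diff_le) auto
    also have "\<dots> \<le> p * u powr (p - 1) * 1" using uv p by (intro mult_left_mono) auto
    finally show ?thesis
      using False powr_mono2[of p v u] p uv by (simp add: N_def N'_def p_def[symmetric] max_def)
  qed
  have "(max u v) powr (p - 1) \<le> (2 * u) powr (p - 1)" using uv p by (intro powr_mono2) auto
  also have "\<dots> = 2 powr (p - 1) * u powr (p - 1)" using uv by (simp add: powr_mult)
  also have "\<dots> \<le> M * N powr (1 - \<tau>)"
  proof (rule mult_mono)
    show "2 powr (p - 1) \<le> M" unfolding M_def p_def[symmetric] by simp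
    have "u powr (p - 1) = (u powr p) powr (1 - \<tau>)"
      using \<tau> by (simp add: powr_powr p_def diff_divide_distrib)
    also have "\<dots> \<le> N powr (1 - \<tau>)" using A up \<tau> by (intro powr_mono2) (auto simp: N_def p_def)
    finally show "u powr (p - 1) \<le> N powr (1 - \<tau>)" .
  qed (auto simp: M_def)
  finally have "p * (max u v) powr (p - 1) \<le> p * (M * N powr (1 - \<tau>))"
    using p by (intro mult_left_mono) auto
  with upper have diff: "\<bar>N - N'\<bar> \<le> p * M * N powr (1 - \<tau>)" by simp
  have "1 / N' - 1 / N = (N - N') * (1 / N) * (1 / N')" using N by (simp add: field_simps)
  then have "\<bar>1 / N' - 1 / N\<bar> = \<bar>N - N'\<bar> * (1 / N) * (1 / N')"
    using N by (simp add: abs_mult)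
  also have "\<dots> \<le> (p * M * N powr (1 - \<tau>)) * (1 / N) * (M * (1 / N))"
    using N p M1 by (intro mult_mono diff 1) auto
  also have "\<dots> = M\<^sup>2 / \<tau> * (N powr (1 - \<tau>) * (1 / N) * (1 / N))"
    unfolding p_def power2_eq_square by (simp add: mult_ac)
  also have "N powr (1 - \<tau>) * (1 / N) * (1 / N) = (1 / N) powr (1 + \<tau>)"
  proof -
    have "N powr (1 - \<tau>) = N / N powr \<tau>" "(1 / N) powr (1 + \<tau>) = 1 / (N * N powr \<tau>)"
      using N by (simp_all add: powr_diff powr_add powr_divide)
    then show ?thesis using N by simp
  qed
  finally show "\<bar>1 / N' - 1 / N\<bar> \<le> M\<^sup>2 / \<tau> * (1 / N) powr (1 + \<tau>)" .
qed

section \<open>Summability over integer vectors\<close>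

lemma summable_on_int_powr:
  fixes s :: real
  assumes "1 < s"
  shows "(\<lambda>j::int. (1 + \<bar>of_int j\<bar>) powr - s) summable_on UNIV"
proof -
  let ?f = "\<lambda>j::int. (1 + \<bar>of_int j\<bar> :: real) powr - s"
  have "summable (\<lambda>n. real n powr - s)" using assms by (simp add: summable_real_powr_iff)
  then have "summable (\<lambda>n. real (Suc n) powr - s)" by (subst summable_Suc_iff)
  then have "summable (\<lambda>n. (1 + real n) powr - s)" by (simp add: add.commute)
  then have nat: "(\<lambda>n. (1 + real n) powr - s) summable_on UNIV"
    by (subst summable_on_UNIV_nonneg_real_iff) auto
  have "?f summable_on range int"
    using nat by (subst summable_on_reindex) (auto simp: o_def)
  moreover have "?f summable_on range (\<lambda>n. - int n)"
    using nat by (subst summable_on_reindex) (auto simp: o_def inj_def)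
  moreover have "range int \<union> range (\<lambda>n. - int n) = UNIV"
    by (auto simp: image_iff) (metis int_cases2)
  ultimately show ?thesis using summable_on_union by metis
qed

text \<open>Every finite set of vectors lies in a finite box, over which the sum factors into
  one-dimensional sums.\<close>

lemma summable_on_prod_PiE:
  fixes f :: "'b \<Rightarrow> real"
  assumes "finite (K :: 'a set)" "\<And>j. 0 \<le> f j" "f summable_on UNIV"
  shows "(\<lambda>n. \<Prod>k\<in>K. f (n k)) summable_on (PiE K (\<lambda>_. UNIV))"
proof (rule nonneg_bdd_above_summable_on)
  show "0 \<le> (\<Prod>k\<in>K. f (n k))" for n using assms by (simp add: prod_nonneg)
  show "bdd_above (sum (\<lambda>n. \<Prod>k\<in>K. f (n k)) ` {F. F \<subseteq> PiE K (\<lambda>_. UNIV) \<and> finite F})"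
  proof (rule bdd_aboveI2)
    fix F :: "('a \<Rightarrow> 'b) set"
    assume F: "F \<in> {F. F \<subseteq> PiE K (\<lambda>_. UNIV) \<and> finite F}"
    define B where "B = (\<Union>n\<in>F. n ` K)"
    have B: "finite B" using F assms by (auto simp: B_def)
    have sub: "F \<subseteq> PiE K (\<lambda>_. B)"
    proof (intro subsetI PiE_I)
      fix n k assume n: "n \<in> F"
      show "n k \<in> B" if "k \<in> K" using n that by (auto simp: B_def)
      show "n k = undefined" if "k \<notin> K" using n F that by (auto intro: PiE_arb)
    qed
    have "sum (\<lambda>n. \<Prod>k\<in>K. f (n k)) F \<le> sum (\<lambda>n. \<Prod>k\<in>K. f (n k)) (PiE K (\<lambda>_. B))"
      using B assms sub by (intro sum_mono2) (auto simp: prod_nonneg finite_PiE)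
    also have "\<dots> = (\<Prod>k\<in>K. \<Sum>j\<in>B. f j)"
      using B assms by (subst prod_sum_PiE) auto
    also have "\<dots> \<le> (\<Prod>k\<in>K. infsum f UNIV)"
      using B assms by (intro prod_mono conjI finite_sum_le_infsum sum_nonneg) auto
    finally show "sum (\<lambda>n. \<Prod>k\<in>K. f (n k)) F \<le> (\<Prod>k\<in>K. infsum f UNIV)" .
  qed
qed

section \<open>Gap lengths along the orbit of 0\<close>

locale independent_rotations =
  fixes d :: nat and \<tau> \<rho> :: "nat \<Rightarrow> real"
  assumes d: "0 < d"
    and \<tau>: "\<And>k. k < d \<Longrightarrow> 0 < \<tau> k \<and> \<tau> k < 1"
    and \<tau>_sum: "(\<Sum>k<d. \<tau> k) < 1"
    and indep: "rationally_independent d \<rho>"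
begin

definition point :: "(nat \<Rightarrow> int) \<Rightarrow> int \<Rightarrow> real" where
  "point n m = (\<Sum>k<d. of_int (n k) * \<rho> k) + of_int m"

text \<open>Independence determines the choice only at indices below d, and \<open>height\<close>
  reads no others.\<close>

definition coord :: "real \<Rightarrow> nat \<Rightarrow> int" where
  "coord x = (SOME n. \<exists>m. x = point n m)"

definition height :: "(nat \<Rightarrow> int) \<Rightarrow> real" where
  "height n = (\<Sum>k<d. (1 + \<bar>of_int (n k)\<bar>) powr (1 / \<tau> k))"

definition orbit :: "real set" where
  "orbit = {x. \<exists>n m. x = point n m}"

definition base_len :: "real \<Rightarrow> real" where
  "base_len x = (if x \<in> orbit then 1 / height (coord x) else 0)"

lemma point_inj:
  assumes "point n m = point n' m'" "k < d"
  shows "n k = n' k"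
proof -
  define q where "q k = (of_int (n k - n' k) :: rat)" for k
  have "(\<Sum>k<d. of_rat (q k) * \<rho> k) = of_int (m' - m)"
    using assms(1) by (simp add: point_def q_def of_rat_diff left_diff_distrib sum_subtractf)
  then have "(\<Sum>k<d. of_rat (q k) * \<rho> k) \<in> \<rat>" by simp
  then have "q k = 0" using indep assms(2) unfolding rationally_independent_def by blast
  then show ?thesis by (simp add: q_def)
qed

lemma irrational:
  assumes "k < d"
  shows "\<rho> k \<notin> \<rat>"
proof
  assume "\<rho> k \<in> \<rat>"
  define q where "q j = (if j = k then 1 else 0 :: rat)" for j
  have "(\<Sum>j<d. of_rat (q j) * \<rho> j) = (\<Sum>j<d. if j = k then \<rho> j else 0)"
    by (intro sum.cong) (auto simp: q_def)
  also have "\<dots> = \<rho> k" using assms by simp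
  finally have "(\<Sum>j<d. of_rat (q j) * \<rho> j) \<in> \<rat>" using \<open>\<rho> k \<in> \<rat>\<close> by simp
  then have "q k = 0" using indep assms unfolding rationally_independent_def by blast
  then show False by (simp add: q_def)
qed

lemma point_coord:
  assumes "x \<in> orbit"
  obtains m where "x = point (coord x) m"
  using assms someI_ex[of "\<lambda>n. \<exists>m. x = point n m"] unfolding orbit_def coord_def by blast

lemma base_len_point: "base_len (point n m) = 1 / height n"
proof -
  have o: "point n m \<in> orbit" by (auto simp: orbit_def)
  obtain m' where "point n m = point (coord (point n m)) m'" using point_coord[OF o] .
  then have "coord (point n m) k = n k" if "k < d" for k using point_inj that by metis
  then have "height (coord (point n m)) = height n" by (simp add: height_def)
  then show ?thesis using o by (simp add: base_len_def)
qed

lemma height_ge: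
  assumes "k < d"
  shows "(1 + \<bar>of_int (n k)\<bar>) powr (1 / \<tau> k) \<le> height n"
  unfolding height_def using assms by (intro member_le_sum) auto

lemma height_pos: "0 < height n"
proof -
  have "0 < (1 + \<bar>of_int (n 0)\<bar> :: real) powr (1 / \<tau> 0)" by simp
  then show ?thesis using height_ge[OF d, of n] by linarith
qed

lemma base_len_nonneg: "0 \<le> base_len x"
  using height_pos by (simp add: base_len_def less_imp_le)

lemma point_shift:
  assumes "k < d"
  shows "point n m + \<rho> k = point (n(k := n k + 1)) m"
proof -
  have "(\<Sum>j<d. of_int ((n(k := n k + 1)) j) * \<rho> j) = (\<Sum>j<d. of_int (n j) * \<rho> j + (if j = k then \<rho> j else 0))"
    by (intro sum.cong) (auto simp: algebra_simps)
  also have "\<dots> = (\<Sum>j<d. of_int (n j) * \<rho> j) + \<rho> k"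
    using assms by (simp add: sum.distrib)
  finally show ?thesis by (simp add: point_def)
qed

lemma orbit_shift:
  assumes "k < d"
  shows "x + \<rho> k \<in> orbit \<longleftrightarrow> x \<in> orbit"
proof
  assume "x + \<rho> k \<in> orbit"
  then obtain n m where "x + \<rho> k = point n m" by (auto simp: orbit_def)
  then have "x + \<rho> k = point (n(k := n k - 1)) m + \<rho> k"
    using point_shift[OF assms, of "n(k := n k - 1)" m] by simp
  then show "x \<in> orbit" by (auto simp: orbit_def)
next
  assume "x \<in> orbit"
  then show "x + \<rho> k \<in> orbit" using point_shift[OF assms] by (auto simp: orbit_def)
qed

lemma base_len_periodic: "base_len (x + 1) = base_len x"
proof (cases "x \<in> orbit")
  case True
  then obtain n m where x: "x = point n m" by (auto simp: orbit_def)
  then have "x + 1 = point n (m + 1)" by (simp add: point_def)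
  then show ?thesis using x base_len_point by metis
next
  case False
  have "x + 1 \<notin> orbit"
  proof
    assume "x + 1 \<in> orbit"
    then obtain n m where "x + 1 = point n m" by (auto simp: orbit_def)
    then have "x = point n (m - 1)" by (simp add: point_def)
    then show False using False by (auto simp: orbit_def)
  qed
  then show ?thesis using False by (simp add: base_len_def)
qed

text \<open>Translation by \<open>\<rho> k\<close> moves one coordinate by one. The perturbation
  estimate applies in both directions, and off the orbit both lengths are 0.\<close>

lemma base_len_shift:
  assumes "k < d"
  shows "base_len (x + \<rho> k) \<le> 2 powr (1 / \<tau> k) * base_len x"
    "base_len x \<le> 2 powr (1 / \<tau> k) * base_len (x + \<rho> k)"
    "\<bar>base_len (x + \<rho> k) - base_len x\<bar>
      \<le> (2 powr (1 / \<tau> k))\<^sup>2 / \<tau> k * base_len x powr (1 + \<tau> k)"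
proof -
  have "base_len (x + \<rho> k) \<le> 2 powr (1 / \<tau> k) * base_len x \<and>
    base_len x \<le> 2 powr (1 / \<tau> k) * base_len (x + \<rho> k) \<and>
    \<bar>base_len (x + \<rho> k) - base_len x\<bar>
      \<le> (2 powr (1 / \<tau> k))\<^sup>2 / \<tau> k * base_len x powr (1 + \<tau> k)"
  proof (cases "x \<in> orbit")
    case False
    then show ?thesis using orbit_shift[OF assms] by (simp add: base_len_def)
  next
    case True
    then obtain n m where x: "x = point n m" by (auto simp: orbit_def)
    define n' where "n' = n(k := n k + 1)"
    define A where "A = (\<Sum>j\<in>{..<d} - {k}. (1 + \<bar>of_int (n j)\<bar> :: real) powr (1 / \<tau> j))"
    define u v where "u = (1 + \<bar>of_int (n k)\<bar> :: real)" and "v = (1 + \<bar>of_int (n' k)\<bar> :: real)"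
    have A: "0 \<le> A" by (auto simp: A_def intro: sum_nonneg)
    have u: "height n = u powr (1 / \<tau> k) + A"
      unfolding height_def A_def u_def using assms by (subst sum.remove[of _ k]) auto
    have v: "height n' = v powr (1 / \<tau> k) + A"
      unfolding height_def A_def v_def using assms
      by (subst sum.remove[of _ k]) (auto simp: n'_def intro!: sum.cong)
    have uv: "1 \<le> u" "1 \<le> v" "\<bar>u - v\<bar> \<le> 1" "\<bar>v - u\<bar> \<le> 1" by (auto simp: u_def v_def n'_def)
    have b: "base_len x = 1 / height n" "base_len (x + \<rho> k) = 1 / height n'"
      unfolding x point_shift[OF assms] n'_def by (rule base_len_point)+
    show ?thesis
      unfolding b u v
      using inverse_powr_perturb[OF uv(1-3) A] inverse_powr_perturb[OF uv(2,1,4) A] \<tau>[OF assms] by blast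
  qed
  then show "base_len (x + \<rho> k) \<le> 2 powr (1 / \<tau> k) * base_len x"
    "base_len x \<le> 2 powr (1 / \<tau> k) * base_len (x + \<rho> k)"
    "\<bar>base_len (x + \<rho> k) - base_len x\<bar>
      \<le> (2 powr (1 / \<tau> k))\<^sup>2 / \<tau> k * base_len x powr (1 + \<tau> k)" by auto
qed

text \<open>Since \<open>1 + \<bar>n k\<bar> \<le> height n powr \<tau> k\<close> for each \<open>k\<close>, multiplying over \<open>k\<close> bounds
  \<open>1 / height n\<close> by a product of one-dimensional terms whose exponent exceeds 1 exactly because
  the \<open>\<tau> k\<close> add up to less than 1.\<close>

lemma inverse_height_le:
  "1 / height n \<le> (\<Prod>k<d. (1 + \<bar>of_int (n k)\<bar>) powr - (1 / (\<Sum>k<d. \<tau> k)))"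
proof -
  define s where "s = (\<Sum>k<d. \<tau> k)"
  have s: "0 < s" unfolding s_def using d \<tau> by (intro sum_pos) auto
  have "(\<Prod>k<d. (1 + \<bar>of_int (n k)\<bar> :: real)) \<le> (\<Prod>k<d. height n powr \<tau> k)"
  proof (intro prod_mono conjI)
    fix k assume k: "k \<in> {..<d}"
    have "(1 + \<bar>of_int (n k)\<bar> :: real) = ((1 + \<bar>of_int (n k)\<bar>) powr (1 / \<tau> k)) powr \<tau> k"
      using \<tau>[of k] k by (simp add: powr_powr)
    also have "\<dots> \<le> height n powr \<tau> k"
      using height_ge[of k n] \<tau>[of k] k by (intro powr_mono2) auto
    finally show "(1 + \<bar>of_int (n k)\<bar> :: real) \<le> height n powr \<tau> k" .
  qed auto
  also have "\<dots> = height n powr s"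
    using height_pos[of n] by (simp add: s_def powr_sum)
  finally have P: "(\<Prod>k<d. (1 + \<bar>of_int (n k)\<bar> :: real)) \<le> height n powr s" .
  have pos: "0 < (\<Prod>k<d. (1 + \<bar>of_int (n k)\<bar> :: real))" by (intro prod_pos) auto
  have "1 / height n = (height n powr s) powr - (1 / s)"
    using s height_pos[of n] by (simp add: powr_powr powr_minus_divide)
  also have "\<dots> \<le> (\<Prod>k<d. (1 + \<bar>of_int (n k)\<bar> :: real)) powr - (1 / s)"
    using P pos s by (intro powr_mono2') auto
  also have "\<dots> = (\<Prod>k<d. (1 + \<bar>of_int (n k)\<bar>) powr - (1 / s))"
    by (subst prod_powr_distrib) auto
  finally show ?thesis by (simp add: s_def)
qed

text \<open>An orbit point in [0, 1) is determined by its coefficients, because two such points with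
  equal coefficients differ by an integer. The sum is therefore dominated by one over integer
  vectors.\<close>

lemma base_len_summable: "base_len summable_on {0..<1}"
proof -
  define s where "s = (\<Sum>k<d. \<tau> k)"
  have s: "0 < s" unfolding s_def using d \<tau> by (intro sum_pos) auto
  define f where "f j = (1 + \<bar>of_int j\<bar> :: real) powr - (1 / s)" for j :: int
  define g where "g n = (\<Prod>k<d. f (n k))" for n
  \<comment> \<open>Restriction discards the arbitrary values of \<open>coord\<close> beyond d and
    lands in \<open>PiE\<close>.\<close>
  define h where "h x = restrict (coord x) {..<d}" for x
  define A where "A = orbit \<inter> {0..<1}"
  have "f summable_on UNIV"
    unfolding f_def using s \<tau>_sum by (intro summable_on_int_powr) (simp add: s_def)
  moreover have "0 \<le> f j" for j by (simp add: f_def)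
  ultimately have "g summable_on (PiE {..<d} (\<lambda>_. UNIV))"
    unfolding g_def by (intro summable_on_prod_PiE) auto
  moreover have "h ` A \<subseteq> PiE {..<d} (\<lambda>_. UNIV)"
    unfolding h_def by (intro image_subsetI) simp
  ultimately have gh: "g summable_on h ` A"
    by (rule summable_on_subset)
  have "inj_on h A"
  proof (rule inj_onI)
    fix x y assume xy: "x \<in> A" "y \<in> A" "h x = h y"
    obtain m where m: "x = point (coord x) m" using point_coord xy(1) by (auto simp: A_def)
    obtain m' where m': "y = point (coord y) m'" using point_coord xy(2) by (auto simp: A_def)
    have "coord x k = coord y k" if "k < d" for k
      using fun_cong[OF xy(3), of k] that by (simp add: h_def)
    then have "x - y = of_int (m - m')"
      using m m' by (simp add: point_def)
    moreover have "\<bar>x - y\<bar> < 1" using xy by (auto simp: A_def)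
    ultimately show "x = y" by (simp flip: of_int_diff of_int_abs)
  qed
  with gh have "(\<lambda>x. g (h x)) summable_on A"
    by (subst (asm) summable_on_reindex) (auto simp: o_def)
  then have "base_len summable_on A"
  proof (rule summable_on_comparison_test)
    fix x assume "x \<in> A"
    have "g (h x) = g (coord x)" unfolding g_def h_def by (intro prod.cong) auto
    moreover have "base_len x = 1 / height (coord x)"
      using \<open>x \<in> A\<close> by (simp add: A_def base_len_def)
    ultimately show "base_len x \<le> g (h x)"
      using inverse_height_le[of "coord x"] by (simp add: g_def f_def s_def)
  qed (rule base_len_nonneg)
  then show ?thesis
    by (subst summable_on_cong_neutral[where T = A and g = base_len]) (auto simp: A_def base_len_def)
qed

text \<open>With S the sum of \<open>base_len\<close> over a period, the scaled total is S / (1 + S)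
  < 1.\<close>

definition gap_scale :: real where
  "gap_scale = 1 / (1 + infsum base_len {0..<1})"

lemma gap_scale_pos: "0 < gap_scale"
  unfolding gap_scale_def using infsum_nonneg[of "{0..<1}" base_len] base_len_nonneg by (simp add: add_pos_nonneg)

sublocale gap_lengths "\<lambda>x. gap_scale * base_len x"
proof
  show "infsum (\<lambda>x. gap_scale * base_len x) {0..<1} < 1"
    using infsum_nonneg[of "{0..<1}" base_len] base_len_nonneg
    by (simp only: infsum_cmult_right') (simp add: gap_scale_def)
qed (use gap_scale_pos base_len_nonneg base_len_summable in
    \<open>auto simp: base_len_periodic less_imp_le intro: summable_on_cmult_right\<close>)

lemma lift_rho:
  assumes "k < d"
  shows "gap_invariant (\<rho> k)" "circle_diffeo (lift (\<rho> k))" "C1_holder (\<tau> k) (lift (\<rho> k))"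
proof -
  define M where "M = (2::real) powr (1 / \<tau> k)"
  \<comment> \<open>Scaling by \<open>gap_scale\<close> multiplies the change of length by that
    factor and the power of the length by its power 1 + \<open>\<tau> k\<close>, which leaves
    \<open>gap_scale powr - \<tau> k\<close>.\<close>
  define C where "C = M\<^sup>2 / \<tau> k * gap_scale powr - \<tau> k"
  have t: "0 < \<tau> k" "\<tau> k < 1" using \<tau>[OF assms] by auto
  have M1: "1 \<le> M" unfolding M_def using t by (intro ge_one_powr_ge_zero) auto
  have M2: "gap_scale * base_len (x + \<rho> k) \<le> M * (gap_scale * base_len x)"
    and M3: "gap_scale * base_len x \<le> M * (gap_scale * base_len (x + \<rho> k))" for x
    using base_len_shift[OF assms, of x, folded M_def] gap_scale_pos by (simp_all add: mult.left_commute)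
  have C: "\<bar>gap_scale * base_len (x + \<rho> k) - gap_scale * base_len x\<bar> \<le> C * (gap_scale * base_len x) powr (1 + \<tau> k)" for x
  proof -
    have "\<bar>gap_scale * base_len (x + \<rho> k) - gap_scale * base_len x\<bar> = gap_scale * \<bar>base_len (x + \<rho> k) - base_len x\<bar>"
      using gap_scale_pos by (simp add: abs_mult flip: right_diff_distrib)
    also have "\<dots> \<le> gap_scale * (M\<^sup>2 / \<tau> k * base_len x powr (1 + \<tau> k))"
      using gap_scale_pos by (intro mult_left_mono base_len_shift(3)[OF assms, of x, folded M_def]) simp
    also have "\<dots> = (gap_scale powr - \<tau> k * gap_scale powr (1 + \<tau> k)) *
        (M\<^sup>2 / \<tau> k * base_len x powr (1 + \<tau> k))"
      using gap_scale_pos by (simp flip: powr_add)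
    also have "\<dots> = C * (gap_scale * base_len x) powr (1 + \<tau> k)"
      using gap_scale_pos base_len_nonneg[of x] by (simp add: C_def powr_mult)
    finally show ?thesis .
  qed
  have C0: "0 \<le> C" using t by (simp add: C_def)
  show "gap_invariant (\<rho> k)" "circle_diffeo (lift (\<rho> k))" "C1_holder (\<tau> k) (lift (\<rho> k))"
    by (rule lift_regular[OF M1 M2 M3 C C0 t])+
qed

end

theorem theoremB:
  fixes d :: nat and \<tau> \<rho> :: "nat \<Rightarrow> real"
  assumes "d \<ge> 2"
    and "\<forall>k<d. 0 < \<tau> k \<and> \<tau> k < 1"
    and "(\<Sum>k<d. \<tau> k) < 1"
    and "rationally_independent d \<rho>"
  shows "\<exists>F :: nat \<Rightarrow> real \<Rightarrow> real.
           (\<forall>i<d. \<forall>j<d. circle_commute (F i) (F j)) \<and>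
           (\<forall>k<d. circle_diffeo (F k) \<and> C1_holder (\<tau> k) (F k) \<and>
                  has_rotation_number (F k) (\<rho> k) \<and> \<not> conj_to_rotation (F k))"
proof -
  interpret independent_rotations d \<tau> \<rho>
    using assms by unfold_locales auto
  have "circle_commute (lift (\<rho> i)) (lift (\<rho> j))" if "i < d" "j < d" for i j
    using lift_commute[OF lift_rho(1)[OF that(2)] lift_rho(1)[OF that(1)]]
    by (simp add: circle_commute_def)
  moreover have "has_rotation_number (lift (\<rho> k)) (\<rho> k)" if "k < d" for k
    by (rule lift_rotation_number[OF lift_rho(1)[OF that]])
  moreover have "\<not> conj_to_rotation (lift (\<rho> k))" if "k < d" for k
  proof (rule lift_not_conj_to_rotation[OF lift_rho(1)[OF that] irrational[OF that]])
    show "continuous_on UNIV (lift (\<rho> k))"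
      using lift_rho(2)[OF that] unfolding circle_diffeo_def
      by (meson DERIV_isCont continuous_at_imp_continuous_on)
    \<comment> \<open>The gap at 0, the orbit point with zero coefficients, is
      nondegenerate.\<close>
    show "0 < gap_scale * base_len (point (\<lambda>_. 0) 0)"
      using gap_scale_pos height_pos by (simp add: base_len_point)
  qed
  ultimately show ?thesis
    using lift_rho(2,3) by (intro exI[of _ "\<lambda>k. lift (\<rho> k)"]) auto
qed

end
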